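(* For the facilitated totally asymmetric simple exclusion process (FTASEP) on $\mathbb{Z}$ with semigroup $S(t)$, $$\lim_{t\to\infty}\nu_{1/2}S(t)=\tfrac12\,\delta_{\bm{\eta}^1}+\tfrac12\,\delta_{\bm{\eta}^0},$$ where the limit is in the sense of weak convergence of probability measures on $\{0,1\}^{\mathbb{Z}}$.
   Context: State space: $\mathbf{X}=\{0,1\}^{\mathbb{Z}}$ (product topology); $\eta(x)=1$ means there is a particle at $x$, $\eta(x)=0$ a hole. FTASEP: the Feller Markov process $(\eta_t)_{t\ge 0}$ on $\mathbf{X}$ whose infinitesimal generator acts on cylinder functions $f$ (functions depending on finitely many coordinates) by $$\mathcal{L}f(\eta)=\sum_{x\in\mathbb{Z}}\eta(x-1)\eta(x)[1-\eta(x+1)]\,[f(\eta^{x,x+1})-f(\eta)],$$ where $\eta^{x,x+1}$ is obtained from $\eta$ by exchanging the values at $x$ and $x+1$. That is, a particle at $x$ jumps to $x+1$ at rate $1$ provided $x+1$ is empty and $x-1$ is occupied. $S(t)$ is the semigroup with generator $\mathcal{L}$, and $\mu S(t)$ is the distribution of the process at time $t$ when the initial distribution is $\mu$. $\nu_{1/2}$ is the product measure on $\{0,1\}^{\mathbb{Z}}$ with $\nu_{1/2}\{\eta:\eta(x)=1\}=1/2$ for all $x$. The alternating configurations are: $\bm{\eta}^1(x)=1$ if and only if $x$ is odd; $\bm{\eta}^0(x)=1$ if and only if $x$ is even. $\delta_\eta$ is the Dirac measure at the configuration $\eta$. *)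

theory Defs
  imports "HOL-Probability.Probability"
begin

(* A configuration is a function int => bool (True = particle), carrying the library's product
   topology of discrete spaces and its Borel sigma-algebra. *)
type_synonym config = "int \<Rightarrow> bool"

definition cylinder :: "(config \<Rightarrow> real) \<Rightarrow> bool" where
  "cylinder f \<longleftrightarrow> (\<exists>A. finite A \<and> (\<forall>\<eta> \<xi>. (\<forall>x\<in>A. \<eta> x = \<xi> x) \<longrightarrow> f \<eta> = f \<xi>))"

definition exchange :: "int \<Rightarrow> int \<Rightarrow> config \<Rightarrow> config" where
  "exchange x y \<eta> = \<eta>(x := \<eta> y, y := \<eta> x)"

(* For a cylinder function only finitely many summands are nonzero. *)
definition ftasep_gen :: "(config \<Rightarrow> real) \<Rightarrow> config \<Rightarrow> real" where
  "ftasep_gen f \<eta> = (\<Sum>\<^sub>\<infinity>x::int.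
     of_bool (\<eta> (x - 1)) * of_bool (\<eta> x) * (1 - of_bool (\<eta> (x + 1)))
       * (f (exchange x (x + 1) \<eta>) - f \<eta>))"

(* P t eta is the law at time t of the process started from eta. The associated semigroup on
   continuous functions is S(t) f = (\<lambda>eta. \<integral>xi. f xi \<partial>P t eta). The configuration space is
   compact, so every continuous function is bounded and vanishes at infinity. *)
locale feller_process =
  fixes P :: "real \<Rightarrow> config \<Rightarrow> config measure"
  assumes kernel: "0 \<le> t \<Longrightarrow> P t \<in> borel \<rightarrow>\<^sub>M prob_algebra borel"
    and start: "P 0 \<eta> = return borel \<eta>"
    and chapman_kolmogorov: "0 \<le> s \<Longrightarrow> 0 \<le> t \<Longrightarrow> P (s + t) \<eta> = bind (P s \<eta>) (P t)"
    and feller: "0 \<le> t \<Longrightarrow> continuous_on UNIV f \<Longrightarrow>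
      continuous_on UNIV (\<lambda>\<eta>. \<integral>\<xi>. (f \<xi> :: real) \<partial>P t \<eta>)"
    and strongly_continuous: "continuous_on UNIV f \<Longrightarrow>
      uniform_limit UNIV (\<lambda>t \<eta>. \<integral>\<xi>. (f \<xi> :: real) \<partial>P t \<eta>) f (at_right 0)"

(* f is in the domain of the infinitesimal generator, which maps it to g. *)
definition generator_maps ::
  "(real \<Rightarrow> config \<Rightarrow> config measure) \<Rightarrow> (config \<Rightarrow> real) \<Rightarrow> (config \<Rightarrow> real) \<Rightarrow> bool" where
  "generator_maps P f g \<longleftrightarrow> continuous_on UNIV f \<and> continuous_on UNIV g \<and>
     uniform_limit UNIV (\<lambda>t \<eta>. ((\<integral>\<xi>. f \<xi> \<partial>P t \<eta>) - f \<eta>) / t) g (at_right 0)"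

(* Cylinder functions form a core of the generator, so this determines P t for t \<ge> 0. *)
locale ftasep = feller_process P for P +
  assumes generator: "cylinder f \<Longrightarrow> generator_maps P f (ftasep_gen f)"

(* The distribution at time t, written mu S(t), for initial distribution mu. *)
definition evolve ::
  "config measure \<Rightarrow> (real \<Rightarrow> config \<Rightarrow> config measure) \<Rightarrow> real \<Rightarrow> config measure" where
  "evolve \<mu> P t = bind \<mu> (P t)"

definition bernoulli_product :: "real \<Rightarrow> config measure" where
  "bernoulli_product \<rho> = Pi\<^sub>M UNIV (\<lambda>_. measure_pmf (bernoulli_pmf \<rho>))"

definition alt1 :: config where "alt1 x = odd x"

definition alt0 :: config where "alt0 x = even x"

definition alternating_mixture :: "config measure" where
  "alternating_mixture = measure_of UNIV (sets borel)
     (\<lambda>A. 1/2 * emeasure (return borel alt1) A + 1/2 * emeasure (return borel alt0) A)"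

definition weakly_converges ::
  "('b \<Rightarrow> 'a::topological_space measure) \<Rightarrow> 'a measure \<Rightarrow> 'b filter \<Rightarrow> bool" where
  "weakly_converges M N F \<longleftrightarrow> (\<forall>f::'a \<Rightarrow> real. continuous_on UNIV f \<and> bounded (range f) \<longrightarrow>
     ((\<lambda>t. \<integral>\<xi>. f \<xi> \<partial>M t) \<longlongrightarrow> (\<integral>\<xi>. f \<xi> \<partial>N)) F)"

(* The measures above are Borel probability measures, as weak convergence requires. *)

instance bool :: second_countable_topology
proof
  have "open = generate_topology (UNIV :: bool set set)"
    by (rule ext) (simp add: Topological_Spaces.open_discrete generate_topology.Basis)
  moreover have "countable (UNIV :: bool set set)"
    by (rule countable_finite) (rule finite)
  ultimately show "\<exists>B::bool set set. countable B \<and> open = generate_topology B"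
    by (intro exI conjI)
qed

lemma bernoulli_product_prob: "bernoulli_product \<rho> \<in> space (prob_algebra borel)"
proof -
  interpret product_prob_space "\<lambda>_::int. measure_pmf (bernoulli_pmf \<rho>)" UNIV
    by unfold_locales
  have "sets (bernoulli_product \<rho>) = sets (Pi\<^sub>M UNIV (\<lambda>_::int. borel :: bool measure))"
    unfolding bernoulli_product_def
    by (rule sets_PiM_cong) (auto simp: sets_borel_eq_count_space)
  also have "\<dots> = sets borel"
    by (rule sets_PiM_equal_borel)
  finally show ?thesis
    using prob_space_axioms by (simp add: space_prob_algebra bernoulli_product_def)
qed

lemma sets_alternating_mixture: "sets alternating_mixture = sets borel"
  unfolding alternating_mixture_def using sets.sigma_sets_eq[of "borel :: config measure"]
  by (simp add: sets_measure_of_conv)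

lemma emeasure_alternating_mixture:
  assumes "A \<in> sets borel"
  shows "emeasure alternating_mixture A =
    1/2 * emeasure (return borel alt1) A + 1/2 * emeasure (return borel alt0) A"
proof (rule emeasure_measure_of[OF alternating_mixture_def])
  show "countably_additive (sets alternating_mixture)
     (\<lambda>A. 1/2 * emeasure (return borel alt1) A + 1/2 * emeasure (return borel alt0) A)"
    unfolding countably_additive_def
  proof (intro allI impI)
    fix A :: "nat \<Rightarrow> config set"
    assume A: "range A \<subseteq> sets alternating_mixture" "disjoint_family A"
    have B: "range A \<subseteq> sets (return borel c)" for c
      using A(1) by (simp add: sets_alternating_mixture)
    show "(\<Sum>i. 1/2 * emeasure (return borel alt1) (A i) + 1/2 * emeasure (return borel alt0) (A i))
      = 1/2 * emeasure (return borel alt1) (\<Union>i. A i) + 1/2 * emeasure (return borel alt0) (\<Union>i. A i)"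
      using suminf_emeasure[OF B A(2)] by (simp add: suminf_add[symmetric])
  qed
  show "positive (sets alternating_mixture)
     (\<lambda>A. 1/2 * emeasure (return borel alt1) A + 1/2 * emeasure (return borel alt0) A)"
    by (simp add: positive_def)
  show "A \<in> sets alternating_mixture"
    using assms by (simp add: sets_alternating_mixture)
qed simp

lemma alternating_mixture_prob: "alternating_mixture \<in> space (prob_algebra borel)"
proof -
  have "(1/2::ennreal) + 1/2 = 1"
    by (simp flip: add_divide_distrib_ennreal)
  then have "emeasure alternating_mixture (space alternating_mixture) = 1"
    using sets_eq_imp_space_eq[OF sets_alternating_mixture]
    by (simp add: emeasure_alternating_mixture)
  then show ?thesis
    by (simp add: space_prob_algebra sets_alternating_mixture prob_spaceI)
qed

lemma (in feller_process) evolve_prob: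
  assumes "\<mu> \<in> space (prob_algebra borel)" "0 \<le> t"
  shows "evolve \<mu> P t \<in> space (prob_algebra borel)"
  using prob_space_bind'[OF assms(1) kernel[OF assms(2)]] sets_bind'[OF assms(1) kernel[OF assms(2)]]
  by (simp add: space_prob_algebra evolve_def)

end

theory Submission
  imports Defs
begin

text \<open>A jump of the process never creates two adjacent holes, and two adjacent holes can only be destroyed by a
particle that arrives from the left (\<open>double_hole_jump\<close>). Suppose that 0 and 1 are empty and that one of the
windows \<open>{- m..-1}\<close> contains at least \<open>(m + 2) / 2\<close> particles. Nothing leaves the window before the pair of holes is
filled, so the window keeps this many particles; hence two of them are adjacent, and the last adjacent pair
provides a particle that can jump, at rate one. But the window has room for at most about \<open>m\<^sup>2\<close> jumps. The expected
lifetime of the double hole is therefore finite, and the probability that it survives to time \<open>T\<close> is of order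
\<open>1 / T\<close> (\<open>double_hole_survival\<close>). Under the fair product measure the excess of particles over holes to the left of
0 is a symmetric random walk, which reaches level 2 almost surely (\<open>AE_dense_window\<close>); so a suitable window exists
almost surely and double holes disappear (\<open>double_hole_vanishes\<close>).

The process conserves particles, so the density stays 1/2 (\<open>density_half\<close>), and at density 1/2 double particles are
as likely as double holes (\<open>equal_neighbours\<close>). Thus both disappear, the configuration alternates on every
fixed window with probability tending to one, and its phase is given by the value at 0, which is a fair coin
at all times.

The density argument uses that the law at time \<open>t\<close> is invariant under translations. This amounts to a uniqueness
property of the semigroup, which is known only through its generator on cylinder functions.
It follows from Kolmogorov's forward equation (\<open>kolmogorov_forward\<close>): the failure of invariance, tested on a cylinder
function, obeys a linear hierarchy of equations whose \<open>K\<close>-th remainder is bounded by the \<open>K\<close>-th iterate of the generator times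
\<open>t ^ K / fact K\<close> (\<open>translation_defect_le\<close>). As the support of a cylinder function grows only by three sites per application of
the generator, these remainders vanish for short times (\<open>iterated_gen_small_time\<close>), and the short time interval does not
depend on the function, so it can be iterated.\<close>

section \<open>The generator on cylinder functions\<close>

text \<open>The sets of coordinates are kept explicit because the growth of the supports under iteration of the
generator decides whether its exponential series converges.\<close>

definition determined_by :: "int set \<Rightarrow> (config \<Rightarrow> real) \<Rightarrow> bool" where
  "determined_by A f \<longleftrightarrow> (\<forall>\<eta> \<xi>. (\<forall>x\<in>A. \<eta> x = \<xi> x) \<longrightarrow> f \<eta> = f \<xi>)"

lemma determined_byD: "determined_by A f \<Longrightarrow> (\<And>x. x \<in> A \<Longrightarrow> \<eta> x = \<xi> x) \<Longrightarrow> f \<eta> = f \<xi>"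
  unfolding determined_by_def by blast

lemma determined_by_mono: "determined_by A f \<Longrightarrow> A \<subseteq> B \<Longrightarrow> determined_by B f"
  unfolding determined_by_def by blast

lemma cylinder_if_determined_by: "determined_by {a..b} f \<Longrightarrow> cylinder f"
  unfolding cylinder_def determined_by_def by (intro exI[of _ "{a..b}"]) auto

lemma cylinder_determined_by_interval:
  assumes "cylinder f"
  obtains a b :: int where "a \<le> b" "determined_by {a..b} f"
proof -
  obtain A where A: "finite A" "determined_by A f"
    using assms unfolding cylinder_def determined_by_def by blast
  define B where "B = insert 0 A"
  have "A \<subseteq> {Min B..Max B}" "Min B \<le> Max B"
    using A(1) by (auto simp: B_def intro!: order_trans[OF Min_le Max_ge])
  then show thesis
    using that determined_by_mono[OF A(2)] by blast
qed

lemma cylinder_bounded: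
  assumes "cylinder f"
  obtains M where "M \<ge> 0" "\<And>\<eta>. \<bar>f \<eta>\<bar> \<le> M"
proof -
  obtain A where A: "finite A" "determined_by A f"
    using assms unfolding cylinder_def determined_by_def by blast
  have "f \<eta> \<in> (\<lambda>B. f (\<lambda>x. x \<in> B)) ` Pow A" for \<eta>
  proof (rule image_eqI)
    show "f \<eta> = f (\<lambda>x. x \<in> {x\<in>A. \<eta> x})"
      by (rule determined_byD[OF A(2)]) auto
  qed auto
  then have "range f \<subseteq> (\<lambda>B. f (\<lambda>x. x \<in> B)) ` Pow A"
    by blast
  then have "finite (range f)"
    using A(1) by (meson finite_Pow_iff finite_imageI finite_subset)
  then have "bounded (range f)"
    by (rule finite_imp_bounded)
  then obtain M where M: "\<And>\<eta>. \<bar>f \<eta>\<bar> \<le> M"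
    unfolding bounded_iff by auto
  moreover have "M \<ge> 0"
    using M[of "\<lambda>_. False"] by linarith
  ultimately show thesis
    using that by blast
qed

text \<open>The contribution of the bond between \<open>x\<close> and \<open>x + 1\<close> to the generator. Sign conditions on the generator are
checked bond by bond.\<close>

definition jump_term :: "(config \<Rightarrow> real) \<Rightarrow> config \<Rightarrow> int \<Rightarrow> real" where
  "jump_term f \<eta> x = of_bool (\<eta> (x - 1) \<and> \<eta> x \<and> \<not> \<eta> (x + 1)) * (f (exchange x (x + 1) \<eta>) - f \<eta>)"

lemma ftasep_gen_jump_term: "ftasep_gen f \<eta> = (\<Sum>\<^sub>\<infinity>x. jump_term f \<eta> x)"
  unfolding ftasep_gen_def jump_term_def by (intro infsum_cong) (auto simp: of_bool_def)

lemma exchange_jump: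
  assumes "\<eta> x" "\<not> \<eta> (x + 1)"
  shows "exchange x (x + 1) \<eta> y = (if y = x then False else if y = x + 1 then True else \<eta> y)"
  using assms by (auto simp: exchange_def)

lemma jump_term_eq_0:
  assumes "determined_by {a..b} f" "x \<notin> {a-1..b}"
  shows "jump_term f \<eta> x = 0"
proof -
  have "f (exchange x (x + 1) \<eta>) = f \<eta>"
    by (rule determined_byD[OF assms(1)]) (use assms(2) in \<open>auto simp: exchange_def\<close>)
  then show ?thesis by (simp add: jump_term_def)
qed

lemma ftasep_gen_eq_sum:
  assumes "determined_by {a..b} f"
  shows "ftasep_gen f \<eta> = (\<Sum>x\<in>{a-1..b}. jump_term f \<eta> x)"
proof -
  have "ftasep_gen f \<eta> = infsum (jump_term f \<eta>) {a-1..b}"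
    unfolding ftasep_gen_jump_term
    by (rule infsum_cong_neutral) (use jump_term_eq_0[OF assms] in auto)
  then show ?thesis by simp
qed

text \<open>The bonds that can change \<open>f\<close> are those that meet \<open>{a..b}\<close>; the leftmost of them, at \<open>a - 1\<close>, has a rate that
looks at \<open>a - 2\<close>, and the rightmost one, at \<open>b\<close>, reaches \<open>b + 1\<close>. The support therefore grows by three sites per
application.\<close>

lemma determined_by_ftasep_gen:
  assumes "determined_by {a..b} f"
  shows "determined_by {a-2..b+1} (ftasep_gen f)"
  unfolding determined_by_def
proof (intro allI impI)
  fix \<eta> \<xi> :: config assume eq: "\<forall>x\<in>{a-2..b+1}. \<eta> x = \<xi> x"
  have "jump_term f \<eta> x = jump_term f \<xi> x" if "x \<in> {a-1..b}" for x
  proof -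
    have "f \<eta> = f \<xi>"
      by (rule determined_byD[OF assms]) (use eq in auto)
    moreover have "f (exchange x (x + 1) \<eta>) = f (exchange x (x + 1) \<xi>)"
      by (rule determined_byD[OF assms]) (use eq that in \<open>auto simp: exchange_def\<close>)
    moreover have "\<eta> (x - 1) = \<xi> (x - 1)" "\<eta> x = \<xi> x" "\<eta> (x + 1) = \<xi> (x + 1)"
      using eq that by auto
    ultimately show ?thesis by (simp add: jump_term_def)
  qed
  then show "ftasep_gen f \<eta> = ftasep_gen f \<xi>"
    by (simp add: ftasep_gen_eq_sum[OF assms])
qed

lemma cylinder_ftasep_gen: "cylinder f \<Longrightarrow> cylinder (ftasep_gen f)"
  by (meson cylinder_determined_by_interval cylinder_if_determined_by determined_by_ftasep_gen)

lemma abs_ftasep_gen_le: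
  assumes det: "determined_by {a..b} f" and "a \<le> b" and M: "\<And>\<eta>. \<bar>f \<eta>\<bar> \<le> M"
  shows "\<bar>ftasep_gen f \<eta>\<bar> \<le> 2 * real_of_int (b - a + 2) * M"
proof -
  have "\<bar>jump_term f \<eta> x\<bar> \<le> 2 * M" for x
    using M[of "exchange x (x + 1) \<eta>"] M[of \<eta>] by (auto simp: jump_term_def of_bool_def)
  then have "\<bar>ftasep_gen f \<eta>\<bar> \<le> real (card {a-1..b}) * (2 * M)"
    unfolding ftasep_gen_eq_sum[OF det]
    by (intro order_trans[OF sum_abs] sum_bounded_above)
  also have "real (card {a-1..b}) = real_of_int (b - a + 2)"
    using \<open>a \<le> b\<close> by simp
  finally show ?thesis by (simp add: mult_ac)
qed

lemma ftasep_gen_le_term: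
  assumes "cylinder f" and le: "\<And>x. jump_term f \<eta> x \<le> 0"
  shows "ftasep_gen f \<eta> \<le> jump_term f \<eta> y"
proof -
  obtain a b where det: "determined_by {a..b} f"
    using assms(1) by (rule cylinder_determined_by_interval)
  show ?thesis
  proof (cases "y \<in> {a-1..b}")
    case True
    have "ftasep_gen f \<eta> = jump_term f \<eta> y + sum (jump_term f \<eta>) ({a-1..b} - {y})"
      unfolding ftasep_gen_eq_sum[OF det] using True by (simp add: sum.remove)
    also have "\<dots> \<le> jump_term f \<eta> y"
      using le by (simp add: sum_nonpos)
    finally show ?thesis .
  next
    case False
    then show ?thesis
      unfolding ftasep_gen_eq_sum[OF det] using le
      by (simp add: jump_term_eq_0[OF det False] sum_nonpos del: atLeastAtMost_iff)
  qed
qed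

lemma ftasep_gen_nonpos:
  assumes "cylinder f" "\<And>x. jump_term f \<eta> x \<le> 0"
  shows "ftasep_gen f \<eta> \<le> 0"
  using ftasep_gen_le_term[OF assms] assms(2) by (rule order_trans)

section \<open>Translations and iterates of the generator\<close>

definition translate :: "int \<Rightarrow> config \<Rightarrow> config" where
  "translate k \<eta> = (\<lambda>x. \<eta> (x + k))"

lemma cylinder_translate:
  assumes "cylinder f" shows "cylinder (\<lambda>\<eta>. f (translate k \<eta>))"
proof -
  obtain a b where det: "determined_by {a..b} f"
    using assms by (rule cylinder_determined_by_interval)
  have "determined_by {a+k..b+k} (\<lambda>\<eta>. f (translate k \<eta>))"
    unfolding determined_by_def
    by (intro allI impI determined_byD[OF det]) (auto simp: translate_def)
  then show ?thesis by (rule cylinder_if_determined_by)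
qed

lemma ftasep_gen_translate:
  "ftasep_gen (\<lambda>\<eta>. f (translate k \<eta>)) \<eta> = ftasep_gen f (translate k \<eta>)"
proof -
  have ex: "translate k (exchange (x + k) (x + k + 1) \<eta>) = exchange x (x + 1) (translate k \<eta>)" for x
    by (auto simp: translate_def exchange_def fun_eq_iff add_ac)
  have "ftasep_gen f (translate k \<eta>) =
      (\<Sum>\<^sub>\<infinity>x. jump_term (\<lambda>\<eta>. f (translate k \<eta>)) \<eta> (x + k))"
    unfolding ftasep_gen_jump_term jump_term_def ex by (simp add: translate_def algebra_simps)
  also have "\<dots> = (\<Sum>\<^sub>\<infinity>x. jump_term (\<lambda>\<eta>. f (translate k \<eta>)) \<eta> x)"
    by (rule infsum_reindex_bij_betw[where g="\<lambda>x. x + k"])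
       (auto intro!: bij_betwI[where g="\<lambda>x. x - k"])
  finally show ?thesis by (simp add: ftasep_gen_jump_term)
qed

text \<open>A function supported on \<open>b - a + 1\<close> sites feels \<open>b - a + 2\<close> bonds, and each of them contributes at most
\<open>2 * M\<close>. Measured in units of three sites, the support grows by one unit per application, so the
factors form an arithmetic progression.\<close>

lemma iterated_gen_bound:
  assumes "determined_by {a..b} f" "a \<le> b" "\<And>\<eta>. \<bar>f \<eta>\<bar> \<le> M" "b - a + 2 \<le> 3 * int c"
  shows "\<bar>(ftasep_gen ^^ K) f \<eta>\<bar> \<le> M * (\<Prod>j<K. 6 * real (c + j))"
  using assms
proof (induction K arbitrary: f a b M c)
  case 0
  then show ?case by simp
next
  case (Suc K)
  have "M \<ge> 0"
    using Suc.prems(3)[of "\<lambda>_. True"] by linarith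
  have "\<bar>ftasep_gen f \<eta>\<bar> \<le> 6 * real c * M" for \<eta>
  proof -
    have "real_of_int (b - a + 2) \<le> 3 * real c"
      using Suc.prems(4) by linarith
    then have "2 * real_of_int (b - a + 2) * M \<le> 6 * real c * M"
      using \<open>M \<ge> 0\<close> by (intro mult_right_mono) auto
    then show ?thesis
      using abs_ftasep_gen_le[OF Suc.prems(1-3)] by (rule order_trans[rotated])
  qed
  then have "\<bar>(ftasep_gen ^^ K) (ftasep_gen f) \<eta>\<bar> \<le> (6 * real c * M) * (\<Prod>j<K. 6 * real (Suc c + j))"
    using Suc.prems(2,4)
    by (intro Suc.IH[OF determined_by_ftasep_gen[OF Suc.prems(1)]]) auto
  also have "\<dots> = M * (\<Prod>j<Suc K. 6 * real (c + j))"
    unfolding prod.lessThan_Suc_shift by simp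
  finally show ?case
    by (simp add: funpow_swap1)
qed

text \<open>The iterates grow no faster than \<open>6 ^ K * fact K\<close> times a polynomial in \<open>K\<close>, so the Taylor remainders at time \<open>t\<close>
vanish once \<open>6 * t < 1\<close>. The radius does not depend on the support of \<open>f\<close>, which allows the
argument to be restarted from time to time.\<close>

lemma iterated_gen_small_time:
  assumes "cylinder f" "0 \<le> t" "t \<le> 1/24"
  obtains B where "\<And>K \<eta>. \<bar>(ftasep_gen ^^ K) f \<eta>\<bar> \<le> B K" "(\<lambda>K. B K * t ^ K / fact K) \<longlonglongrightarrow> 0"
proof -
  obtain a b where ab: "a \<le> b" "determined_by {a..b} f"
    using assms(1) by (rule cylinder_determined_by_interval)
  obtain M where M: "M \<ge> 0" "\<And>\<eta>. \<bar>f \<eta>\<bar> \<le> M"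
    using assms(1) by (rule cylinder_bounded) blast
  define c where "c = nat (b - a + 2)"
  have c: "b - a + 2 \<le> 3 * int c"
    using ab(1) by (simp add: c_def)
  define B where "B K = M * (\<Prod>j<K. 6 * real (c + j))" for K
  have "\<bar>(ftasep_gen ^^ K) f \<eta>\<bar> \<le> B K" for K \<eta>
    unfolding B_def by (rule iterated_gen_bound[OF ab(2,1) M(2) c])
  moreover have "(\<lambda>K. B K * t ^ K / fact K) \<longlonglongrightarrow> 0"
  \<comment> \<open>The ratio of consecutive terms is at most \<open>(c + K) / (4 * (K + 1))\<close>, hence at most 1/2 from \<open>K = c\<close> on.\<close>
  proof (rule summable_LIMSEQ_zero[OF summable_ratio_test[of "1/2" c]])
    fix K assume "c \<le> K"
    have B0: "B K * t ^ K / fact K \<ge> 0"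
      using M(1) assms(2) by (simp add: B_def prod_nonneg)
    have "B (Suc K) * t ^ Suc K / fact (Suc K) = (6 * t * real (c + K) / real (Suc K)) * (B K * t ^ K / fact K)"
      by (simp add: B_def field_simps)
    moreover have "6 * t * real (c + K) / real (Suc K) \<le> 1/2"
    proof -
      have "6 * t * real (c + K) \<le> 1/4 * real (c + K)"
        using assms(3) by (intro mult_right_mono) auto
      also have "\<dots> \<le> 1/2 * real (Suc K)"
        using \<open>c \<le> K\<close> by simp
      finally show ?thesis by (simp add: field_simps)
    qed
    moreover have "0 \<le> 6 * t * real (c + K) / real (Suc K)"
      using assms(2) by simp
    ultimately show "norm (B (Suc K) * t ^ Suc K / fact (Suc K)) \<le> 1/2 * norm (B K * t ^ K / fact K)"
      using B0 by (simp only: real_norm_def abs_mult abs_of_nonneg mult_right_mono)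
  qed simp
  ultimately show thesis using that by blast
qed

section \<open>The forward equation\<close>

lemma return_prob_algebra: "return borel \<eta> \<in> space (prob_algebra borel)"
  by (simp add: space_prob_algebra prob_space_return)

context ftasep
begin

abbreviation E :: "config measure \<Rightarrow> real \<Rightarrow> (config \<Rightarrow> real) \<Rightarrow> real" where
  "E \<mu> t f \<equiv> \<integral>\<xi>. f \<xi> \<partial>evolve \<mu> P t"

lemma cylinder_measurable: "cylinder f \<Longrightarrow> f \<in> borel_measurable borel"
  using generator[of f] by (intro borel_measurable_continuous_onI) (simp add: generator_maps_def)

lemma evolve_0:
  assumes "\<mu> \<in> space (prob_algebra borel)"
  shows "evolve \<mu> P 0 = \<mu>"
proof -
  have "P 0 = return borel" using start by blast
  then show ?thesis
    using assms by (simp add: evolve_def bind_return'' space_prob_algebra)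
qed

lemma evolve_add:
  assumes "\<mu> \<in> space (prob_algebra borel)" "0 \<le> s" "0 \<le> t"
  shows "evolve (evolve \<mu> P s) P t = evolve \<mu> P (s + t)"
proof -
  have "P r \<in> measurable \<mu> (subprob_algebra borel)" if "0 \<le> r" for r
    using measurable_prob_algebraD[OF kernel[OF that]] assms(1)
    by (simp add: space_prob_algebra cong: measurable_cong_sets)
  moreover have "P (s + t) = (\<lambda>\<eta>. P s \<eta> \<bind> P t)"
    using chapman_kolmogorov[OF assms(2,3)] by blast
  ultimately show ?thesis
    using measurable_prob_algebraD[OF kernel[OF assms(3)]] assms(2,3)
    by (simp add: evolve_def bind_assoc[where N=borel and R=borel])
qed

lemma evolve_return:
  assumes "0 \<le> t"
  shows "evolve (return borel \<eta>) P t = P t \<eta>"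
  unfolding evolve_def
  by (rule bind_return[OF measurable_prob_algebraD[OF kernel[OF assms]]]) simp

lemma integrable_bounded:
  assumes "\<mu> \<in> space (prob_algebra borel)" "f \<in> borel_measurable borel" "\<And>\<eta>. \<bar>f \<eta> :: real\<bar> \<le> M"
  shows "integrable \<mu> f"
proof -
  have "prob_space \<mu>" and [measurable_cong]: "sets \<mu> = sets borel"
    using assms(1) by (auto simp: space_prob_algebra)
  then interpret prob_space \<mu> by simp
  show ?thesis
    using assms(2,3) by (intro integrable_const_bound[of _ M]) auto
qed

lemma integrable_cylinder:
  assumes "\<mu> \<in> space (prob_algebra borel)" "cylinder f"
  shows "integrable \<mu> f"
  using cylinder_bounded[OF assms(2)] cylinder_measurable[OF assms(2)] assms(1)
  by (metis integrable_bounded)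

lemma integrable_evolve_cylinder:
  "\<mu> \<in> space (prob_algebra borel) \<Longrightarrow> 0 \<le> t \<Longrightarrow> cylinder f \<Longrightarrow> integrable (evolve \<mu> P t) f"
  by (intro integrable_cylinder evolve_prob)

lemma abs_integral_le:
  assumes "\<mu> \<in> space (prob_algebra borel)" "\<And>\<eta>. \<bar>f \<eta> :: real\<bar> \<le> M"
  shows "\<bar>\<integral>\<eta>. f \<eta> \<partial>\<mu>\<bar> \<le> M"
proof -
  interpret prob_space \<mu> using assms(1) by (simp add: space_prob_algebra)
  have "\<bar>\<integral>\<eta>. f \<eta> \<partial>\<mu>\<bar> \<le> (\<integral>\<eta>. M \<partial>\<mu>)"
  proof (cases "integrable \<mu> f")
    case True
    have "\<bar>\<integral>\<eta>. f \<eta> \<partial>\<mu>\<bar> \<le> (\<integral>\<eta>. \<bar>f \<eta>\<bar> \<partial>\<mu>)" by simp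
    also have "\<dots> \<le> (\<integral>\<eta>. M \<partial>\<mu>)"
      using True assms(2) by (intro integral_mono) auto
    finally show ?thesis .
  next
    case False
    moreover have "M \<ge> 0" using assms(2)[of undefined] by linarith
    ultimately show ?thesis by (simp add: not_integrable_integral_eq prob_space)
  qed
  then show ?thesis by (simp add: prob_space)
qed

lemma E_eq_integral_kernel:
  assumes "\<mu> \<in> space (prob_algebra borel)" "0 \<le> t" "f \<in> borel_measurable borel" "\<And>\<eta>. \<bar>f \<eta>\<bar> \<le> M"
  shows "E \<mu> t f = (\<integral>\<eta>. (\<integral>\<xi>. f \<xi> \<partial>P t \<eta>) \<partial>\<mu>)"
proof -
  have mu: "prob_space \<mu>" "sets \<mu> = sets borel" using assms(1) by (auto simp: space_prob_algebra)
  then interpret prob_space \<mu> by simp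
  have "P t \<in> measurable \<mu> (subprob_algebra borel)"
    using measurable_prob_algebraD[OF kernel[OF assms(2)]] mu
    by (simp cong: measurable_cong_sets)
  moreover have "prob_space (P t \<eta>)" for \<eta>
    using measurable_space[OF kernel[OF assms(2)], of \<eta>] by (simp add: space_prob_algebra)
  ultimately show ?thesis
    unfolding evolve_def using assms(3,4)
    by (intro integral_bind[where B'=1 and K=borel and B=M]) (auto simp: prob_space.emeasure_space_1 intro: finite_measure_axioms)
qed

lemma kernel_prob: "0 \<le> t \<Longrightarrow> P t \<eta> \<in> space (prob_algebra borel)"
  using evolve_prob[OF return_prob_algebra] by (simp add: evolve_return)

lemma kernel_integral_measurable:
  assumes "cylinder f" "0 \<le> t"
  shows "(\<lambda>\<eta>. \<integral>\<xi>. f \<xi> \<partial>P t \<eta>) \<in> borel_measurable borel"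
  using measurable_prob_algebraD[OF kernel[OF assms(2)]] cylinder_measurable[OF assms(1)]
    integral_measurable_subprob_algebra[of f borel] by measurable

text \<open>The generator limit is uniform in the starting configuration, so it may be integrated against an
arbitrary initial law, with a \<open>\<delta>\<close> that is the same for all initial laws.\<close>

lemma uniform_first_order:
  assumes f: "cylinder f" and "\<epsilon> > 0"
  obtains \<delta> where "\<delta> > 0"
    "\<And>h \<mu>. 0 < h \<Longrightarrow> h < \<delta> \<Longrightarrow> \<mu> \<in> space (prob_algebra borel) \<Longrightarrow>
      \<bar>E \<mu> h f - (\<integral>\<eta>. f \<eta> \<partial>\<mu>) - h * (\<integral>\<eta>. ftasep_gen f \<eta> \<partial>\<mu>)\<bar> \<le> \<epsilon> * h"
proof -
  have "uniform_limit UNIV (\<lambda>t \<eta>. ((\<integral>\<xi>. f \<xi> \<partial>P t \<eta>) - f \<eta>) / t) (ftasep_gen f) (at_right 0)"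
    using generator[OF f] by (simp add: generator_maps_def)
  from uniform_limitD[OF this \<open>\<epsilon> > 0\<close>]
  obtain \<delta> where "\<delta> > 0" and \<delta>: "\<And>h \<eta>. 0 < h \<Longrightarrow> h < \<delta> \<Longrightarrow>
      dist (((\<integral>\<xi>. f \<xi> \<partial>P h \<eta>) - f \<eta>) / h) (ftasep_gen f \<eta>) < \<epsilon>"
    unfolding eventually_at_right_field by auto
  have "\<bar>E \<mu> h f - (\<integral>\<eta>. f \<eta> \<partial>\<mu>) - h * (\<integral>\<eta>. ftasep_gen f \<eta> \<partial>\<mu>)\<bar> \<le> \<epsilon> * h"
    if h: "0 < h" "h < \<delta>" and mu: "\<mu> \<in> space (prob_algebra borel)" for h \<mu>
  proof -
    obtain M where M: "\<And>\<eta>. \<bar>f \<eta>\<bar> \<le> M" using cylinder_bounded[OF f] by blast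
    have int: "integrable \<mu> (\<lambda>\<eta>. \<integral>\<xi>. f \<xi> \<partial>P h \<eta>)"
      using h(1) M by (intro integrable_bounded[OF mu kernel_integral_measurable[OF f], of _ M]
          abs_integral_le kernel_prob) auto
    have "\<bar>(\<integral>\<xi>. f \<xi> \<partial>P h \<eta>) - f \<eta> - h * ftasep_gen f \<eta>\<bar> \<le> \<epsilon> * h" for \<eta>
    proof -
      have "(\<integral>\<xi>. f \<xi> \<partial>P h \<eta>) - f \<eta> - h * ftasep_gen f \<eta> =
          h * (((\<integral>\<xi>. f \<xi> \<partial>P h \<eta>) - f \<eta>) / h - ftasep_gen f \<eta>)"
        using h(1) by (simp add: field_simps)
      also have "\<bar>\<dots>\<bar> \<le> h * \<epsilon>"
        unfolding abs_mult using h(1) \<delta>[OF h, of \<eta>]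
        by (intro mult_mono) (auto simp: dist_real_def)
      finally show ?thesis by (simp add: mult.commute)
    qed
    from abs_integral_le[OF mu this]
    have "\<bar>\<integral>\<eta>. (\<integral>\<xi>. f \<xi> \<partial>P h \<eta>) - f \<eta> - h * ftasep_gen f \<eta> \<partial>\<mu>\<bar> \<le> \<epsilon> * h" .
    also have "(\<integral>\<eta>. (\<integral>\<xi>. f \<xi> \<partial>P h \<eta>) - f \<eta> - h * ftasep_gen f \<eta> \<partial>\<mu>) =
        E \<mu> h f - (\<integral>\<eta>. f \<eta> \<partial>\<mu>) - h * (\<integral>\<eta>. ftasep_gen f \<eta> \<partial>\<mu>)"
      using h(1) int integrable_cylinder[OF mu f] integrable_cylinder[OF mu cylinder_ftasep_gen[OF f]]
      by (simp add: E_eq_integral_kernel[OF mu _ cylinder_measurable[OF f] M])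
    finally show ?thesis .
  qed
  with \<open>\<delta> > 0\<close> show thesis using that by blast
qed

text \<open>The Markov property turns the expansion at time 0 for the initial law \<open>evolve \<mu> P s\<close> into an expansion at time
\<open>s\<close>.\<close>

lemma E_first_order:
  assumes f: "cylinder f" and "\<epsilon> > 0" and mu: "\<mu> \<in> space (prob_algebra borel)"
  obtains \<delta> where "\<delta> > 0"
    "\<And>s t. 0 \<le> s \<Longrightarrow> s \<le> t \<Longrightarrow> t < s + \<delta> \<Longrightarrow>
      \<bar>E \<mu> t f - E \<mu> s f - (t - s) * E \<mu> s (ftasep_gen f)\<bar> \<le> \<epsilon> * (t - s)"
proof -
  obtain \<delta> where "\<delta> > 0" and \<delta>: "\<And>h \<mu>. 0 < h \<Longrightarrow> h < \<delta> \<Longrightarrow> \<mu> \<in> space (prob_algebra borel) \<Longrightarrow>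
      \<bar>E \<mu> h f - (\<integral>\<eta>. f \<eta> \<partial>\<mu>) - h * (\<integral>\<eta>. ftasep_gen f \<eta> \<partial>\<mu>)\<bar> \<le> \<epsilon> * h"
    using uniform_first_order[OF f \<open>\<epsilon> > 0\<close>] by blast
  have "\<bar>E \<mu> t f - E \<mu> s f - (t - s) * E \<mu> s (ftasep_gen f)\<bar> \<le> \<epsilon> * (t - s)"
    if "0 \<le> s" "s \<le> t" "t < s + \<delta>" for s t
  proof (cases "s = t")
    case False
    then show ?thesis
      using \<delta>[of "t - s" "evolve \<mu> P s"] that evolve_prob[OF mu that(1)]
      by (simp add: evolve_add[OF mu])
  qed simp
  with \<open>\<delta> > 0\<close> show thesis using that by blast
qed

text \<open>A single constant \<open>L\<close> serves both as Lipschitz constant and, through its inverse, as the range of times.\<close>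

lemma E_locally_lipschitz:
  assumes f: "cylinder f" and mu: "\<mu> \<in> space (prob_algebra borel)"
  obtains L where "L > 0" "\<And>s t. 0 \<le> s \<Longrightarrow> s \<le> t \<Longrightarrow> t < s + 1 / L \<Longrightarrow> \<bar>E \<mu> t f - E \<mu> s f\<bar> \<le> L * (t - s)"
proof -
  obtain M where M: "M \<ge> 0" "\<And>\<eta>. \<bar>ftasep_gen f \<eta>\<bar> \<le> M"
    using cylinder_bounded[OF cylinder_ftasep_gen[OF f]] by blast
  obtain \<delta> where "\<delta> > 0" and \<delta>: "\<And>s t. 0 \<le> s \<Longrightarrow> s \<le> t \<Longrightarrow> t < s + \<delta> \<Longrightarrow>
      \<bar>E \<mu> t f - E \<mu> s f - (t - s) * E \<mu> s (ftasep_gen f)\<bar> \<le> 1 * (t - s)"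
    using E_first_order[OF f zero_less_one mu] by blast
  define L where "L = max (M + 1) (1 / \<delta>)"
  have "\<bar>E \<mu> t f - E \<mu> s f\<bar> \<le> L * (t - s)" if st: "0 \<le> s" "s \<le> t" "t < s + 1 / L" for s t
  proof -
    have "1 / L \<le> \<delta>"
      using \<open>\<delta> > 0\<close> M(1) by (simp add: L_def field_simps max_def)
    then have "\<bar>E \<mu> t f - E \<mu> s f - (t - s) * E \<mu> s (ftasep_gen f)\<bar> \<le> 1 * (t - s)"
      using st by (intro \<delta>) auto
    moreover have "\<bar>(t - s) * E \<mu> s (ftasep_gen f)\<bar> \<le> (t - s) * M"
      unfolding abs_mult using st abs_integral_le[OF evolve_prob[OF mu st(1)] M(2)]
      by (intro mult_mono) auto
    ultimately have "\<bar>E \<mu> t f - E \<mu> s f\<bar> \<le> (M + 1) * (t - s)"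
      by (simp add: algebra_simps)
    also have "\<dots> \<le> L * (t - s)"
      using st by (intro mult_right_mono) (auto simp: L_def)
    finally show ?thesis .
  qed
  moreover have "L > 0" using M(1) by (simp add: L_def)
  ultimately show thesis using that by blast
qed

text \<open>To the right of \<open>t\<close> this is the first-order expansion at \<open>t\<close>. To the left, the expansion is made at the earlier time
\<open>s\<close>, and continuity of the expectation of \<open>ftasep_gen f\<close>, which is again a cylinder function, moves the
derivative from \<open>s\<close> to \<open>t\<close>.\<close>

lemma kolmogorov_forward:
  assumes f: "cylinder f" and mu: "\<mu> \<in> space (prob_algebra borel)" and "0 \<le> t"
  shows "((\<lambda>t. E \<mu> t f) has_real_derivative E \<mu> t (ftasep_gen f)) (at t within {0..})"
  unfolding has_field_derivative_def has_derivative_within_alt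
proof (intro conjI allI impI)
  show "bounded_linear ((*) (E \<mu> t (ftasep_gen f)))"
    by (rule bounded_linear_mult_right)
next
  fix \<epsilon> :: real assume "\<epsilon> > 0"
  then have "\<epsilon> / 2 > 0" by simp
  obtain \<delta> where "\<delta> > 0" and \<delta>: "\<And>s t. 0 \<le> s \<Longrightarrow> s \<le> t \<Longrightarrow> t < s + \<delta> \<Longrightarrow>
      \<bar>E \<mu> t f - E \<mu> s f - (t - s) * E \<mu> s (ftasep_gen f)\<bar> \<le> \<epsilon> / 2 * (t - s)"
    using E_first_order[OF f \<open>\<epsilon> / 2 > 0\<close> mu] by blast
  obtain L where "L > 0" and L: "\<And>s t. 0 \<le> s \<Longrightarrow> s \<le> t \<Longrightarrow> t < s + 1 / L \<Longrightarrow>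
      \<bar>E \<mu> t (ftasep_gen f) - E \<mu> s (ftasep_gen f)\<bar> \<le> L * (t - s)"
    using E_locally_lipschitz[OF cylinder_ftasep_gen[OF f] mu] by blast
  define d where "d = min \<delta> (min (1 / L) (\<epsilon> / (2 * L)))"
  have "d > 0" using \<open>\<delta> > 0\<close> \<open>L > 0\<close> \<open>\<epsilon> > 0\<close> by (simp add: d_def)
  moreover have "norm (E \<mu> s f - E \<mu> t f - E \<mu> t (ftasep_gen f) * (s - t)) \<le> \<epsilon> * norm (s - t)"
    if s: "s \<in> {0..}" "norm (s - t) < d" for s
  proof (cases "t \<le> s")
    case True
    then have "\<bar>E \<mu> s f - E \<mu> t f - (s - t) * E \<mu> t (ftasep_gen f)\<bar> \<le> \<epsilon> / 2 * (s - t)"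
      using s \<open>0 \<le> t\<close> by (intro \<delta>) (auto simp: d_def)
    also have "\<dots> \<le> \<epsilon> * (s - t)"
      using True \<open>\<epsilon> > 0\<close> by (intro mult_right_mono) auto
    finally show ?thesis using True by (simp add: mult.commute)
  next
    case False
    have A: "\<bar>E \<mu> t f - E \<mu> s f - (t - s) * E \<mu> s (ftasep_gen f)\<bar> \<le> \<epsilon> / 2 * (t - s)"
      using s False by (intro \<delta>) (auto simp: d_def)
    have "\<bar>E \<mu> t (ftasep_gen f) - E \<mu> s (ftasep_gen f)\<bar> \<le> L * (t - s)"
      using s False by (intro L) (auto simp: d_def)
    also have "\<dots> \<le> L * (\<epsilon> / (2 * L))"
      using s False \<open>L > 0\<close> by (intro mult_left_mono) (auto simp: d_def)
    also have "\<dots> = \<epsilon> / 2" using \<open>L > 0\<close> by simp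
    finally have "(t - s) * \<bar>E \<mu> t (ftasep_gen f) - E \<mu> s (ftasep_gen f)\<bar> \<le> (t - s) * (\<epsilon> / 2)"
      using False by (intro mult_left_mono) auto
    then have B: "\<bar>(t - s) * (E \<mu> t (ftasep_gen f) - E \<mu> s (ftasep_gen f))\<bar> \<le> (t - s) * (\<epsilon> / 2)"
      using False by (simp add: abs_mult)
    have "E \<mu> s f - E \<mu> t f - E \<mu> t (ftasep_gen f) * (s - t) =
        (t - s) * (E \<mu> t (ftasep_gen f) - E \<mu> s (ftasep_gen f))
        - (E \<mu> t f - E \<mu> s f - (t - s) * E \<mu> s (ftasep_gen f))"
      by (simp add: algebra_simps)
    then have "\<bar>E \<mu> s f - E \<mu> t f - E \<mu> t (ftasep_gen f) * (s - t)\<bar> \<le> (t - s) * (\<epsilon> / 2) + \<epsilon> / 2 * (t - s)"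
      using A B by linarith
    also have "\<dots> = \<epsilon> * \<bar>s - t\<bar>" using False by (simp add: field_simps)
    finally show ?thesis by simp
  qed
  ultimately show "\<exists>d>0. \<forall>s\<in>{0..}. norm (s - t) < d \<longrightarrow>
      norm (E \<mu> s f - E \<mu> t f - E \<mu> t (ftasep_gen f) * (s - t)) \<le> \<epsilon> * norm (s - t)"
    by blast
qed

end

lemma nonincreasing_if_derivative_nonpos:
  fixes \<phi> :: "real \<Rightarrow> real"
  assumes "\<And>t. 0 \<le> t \<Longrightarrow> (\<phi> has_real_derivative \<phi>' t) (at t within {0..})"
    and "\<And>t. 0 \<le> t \<Longrightarrow> t \<le> b \<Longrightarrow> \<phi>' t \<le> 0" and "0 \<le> b"
  shows "\<phi> b \<le> \<phi> 0"
proof (rule DERIV_nonpos_imp_decreasing_open[OF \<open>0 \<le> b\<close>])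
  fix t :: real assume t: "0 < t" "t < b"
  then have "at t within {0..} = at t"
    by (intro at_within_interior) simp
  then show "\<exists>y. (\<phi> has_real_derivative y) (at t) \<and> y \<le> 0"
    using assms(1,2)[of t] t by auto
next
  have "continuous_on {0..} \<phi>"
    unfolding continuous_on_eq_continuous_within
    using DERIV_continuous[OF assms(1)] by simp
  then show "continuous_on {0..b} \<phi>"
    by (rule continuous_on_subset) auto
qed

lemma const_if_derivative_0:
  fixes \<phi> :: "real \<Rightarrow> real"
  assumes "\<And>t. 0 \<le> t \<Longrightarrow> (\<phi> has_real_derivative 0) (at t within {0..})" and "0 \<le> b"
  shows "\<phi> b = \<phi> 0"
  using nonincreasing_if_derivative_nonpos[OF assms(1), of b] assms(2)
    nonincreasing_if_derivative_nonpos[of "\<lambda>t. - \<phi> t" "\<lambda>_. 0" b] DERIV_minus[OF assms(1)]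
  by fastforce

section \<open>Translation invariance in time\<close>

definition translation_invariant :: "config measure \<Rightarrow> bool" where
  "translation_invariant \<mu> \<longleftrightarrow>
    (\<forall>k f. cylinder f \<longrightarrow> (\<integral>\<eta>. f (translate k \<eta>) \<partial>\<mu>) = (\<integral>\<eta>. f \<eta> \<partial>\<mu>))"

lemma translation_invariantD:
  "translation_invariant \<mu> \<Longrightarrow> cylinder f \<Longrightarrow> (\<integral>\<eta>. f (translate k \<eta>) \<partial>\<mu>) = (\<integral>\<eta>. f \<eta> \<partial>\<mu>)"
  by (auto simp: translation_invariant_def)

context ftasep
begin

text \<open>The generator commutes with translations, so the defect of \<open>f\<close> starts at 0 and its time derivative is the
defect of \<open>ftasep_gen f\<close>. Iterating \<open>K\<close> times and bounding the last defect trivially by \<open>2 * B\<close> gives the Taylor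
remainder.\<close>

lemma translation_defect_le:
  assumes mu: "\<mu> \<in> space (prob_algebra borel)" and inv: "translation_invariant \<mu>"
  assumes "cylinder f" "\<And>\<eta>. \<bar>(ftasep_gen ^^ K) f \<eta>\<bar> \<le> B" "0 \<le> t"
  shows "\<bar>E \<mu> t (\<lambda>\<eta>. f (translate k \<eta>)) - E \<mu> t f\<bar> \<le> 2 * B * t ^ K / fact K"
  using assms(3-5)
proof (induction K arbitrary: f t)
  case 0
  have "\<bar>E \<mu> t f\<bar> \<le> B" "\<bar>E \<mu> t (\<lambda>\<eta>. f (translate k \<eta>))\<bar> \<le> B"
    using 0 by (auto intro!: abs_integral_le evolve_prob[OF mu])
  then show ?case by simp
next
  case (Suc K)
  define D where "D f t = E \<mu> t (\<lambda>\<eta>. f (translate k \<eta>)) - E \<mu> t f" for f t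
  define L where "L = ftasep_gen f"
  have cyl: "cylinder L"
    unfolding L_def by (rule cylinder_ftasep_gen[OF Suc.prems(1)])
  have "\<bar>(ftasep_gen ^^ K) L \<eta>\<bar> \<le> B" for \<eta>
    using Suc.prems(2)[of \<eta>] by (simp add: L_def funpow_swap1)
  from Suc.IH[OF cyl this]
  have IH: "\<bar>D L s\<bar> \<le> 2 * B * s ^ K / fact K" if "0 \<le> s" for s
    using that by (simp add: D_def)
  have deriv: "(D f has_real_derivative D L s) (at s within {0..})" if "0 \<le> s" for s
    unfolding D_def L_def
    using kolmogorov_forward[OF cylinder_translate[OF Suc.prems(1)] mu that, of k]
      kolmogorov_forward[OF Suc.prems(1) mu that]
    by (auto intro!: DERIV_diff simp: ftasep_gen_translate)
  have D0: "D f 0 = 0"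
    using translation_invariantD[OF inv Suc.prems(1)] by (simp add: D_def evolve_0[OF mu])
  \<comment> \<open>The signs 1 and -1 for \<open>\<sigma>\<close> give the upper and the lower bound on the defect.\<close>
  have "\<sigma> * D f t - 2 * B * t ^ Suc K / fact (Suc K) \<le> \<sigma> * D f 0 - 2 * B * 0 ^ Suc K / fact (Suc K)"
    if sigma: "\<bar>\<sigma>\<bar> = 1" for \<sigma> :: real
  proof (rule nonincreasing_if_derivative_nonpos[OF _ _ Suc.prems(3)])
    fix s :: real assume "0 \<le> s"
    have "((\<lambda>s. 2 * B * s ^ Suc K / fact (Suc K)) has_real_derivative 2 * B * s ^ K / fact K) (at s within {0..})"
    proof -
      have "((\<lambda>s. 2 * B / fact (Suc K) * s ^ Suc K) has_real_derivative
          2 * B / fact (Suc K) * (real (Suc K) * s ^ K)) (at s within {0..})"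
        by (rule DERIV_cmult) (auto intro!: derivative_eq_intros simp del: power_Suc of_nat_Suc)
      moreover have "2 * B / fact (Suc K) * (real (Suc K) * s ^ K) = 2 * B * s ^ K / fact K"
        by (simp only: fact_Suc of_nat_mult) (simp add: divide_simps)
      ultimately show ?thesis
        by (simp only: times_divide_eq_left)
    qed
    then show "((\<lambda>s. \<sigma> * D f s - 2 * B * s ^ Suc K / fact (Suc K)) has_real_derivative
        \<sigma> * D L s - 2 * B * s ^ K / fact K) (at s within {0..})"
      using DERIV_cmult[OF deriv[OF \<open>0 \<le> s\<close>], of \<sigma>] by (rule DERIV_diff[rotated])
    have "\<sigma> * D L s \<le> \<bar>\<sigma> * D L s\<bar>" by simp
    also have "\<dots> = \<bar>D L s\<bar>" using sigma by (simp add: abs_mult)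
    finally show "\<sigma> * D L s - 2 * B * s ^ K / fact K \<le> 0"
      using IH[OF \<open>0 \<le> s\<close>] by linarith
  qed
  from this[of 1] this[of "-1"] have "\<bar>D f t\<bar> \<le> 2 * B * t ^ Suc K / fact (Suc K)"
    by (simp add: D0 abs_le_iff)
  then show ?case by (simp add: D_def)
qed

lemma translation_invariant_evolve_short:
  assumes mu: "\<mu> \<in> space (prob_algebra borel)" and inv: "translation_invariant \<mu>"
    and t: "0 \<le> t" "t \<le> 1/24"
  shows "translation_invariant (evolve \<mu> P t)"
  unfolding translation_invariant_def
proof (intro allI impI)
  fix k f assume f: "cylinder f"
  obtain B where B: "\<And>K \<eta>. \<bar>(ftasep_gen ^^ K) f \<eta>\<bar> \<le> B K" "(\<lambda>K. B K * t ^ K / fact K) \<longlonglongrightarrow> 0"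
    using iterated_gen_small_time[OF f t] by blast
  have "\<bar>E \<mu> t (\<lambda>\<eta>. f (translate k \<eta>)) - E \<mu> t f\<bar> \<le> 2 * (B K * t ^ K / fact K)" for K
    using translation_defect_le[OF mu inv f B(1) t(1)] by (simp add: mult_ac)
  moreover have "(\<lambda>K. 2 * (B K * t ^ K / fact K)) \<longlonglongrightarrow> 2 * 0"
    by (intro tendsto_intros B(2))
  ultimately have "\<bar>E \<mu> t (\<lambda>\<eta>. f (translate k \<eta>)) - E \<mu> t f\<bar> \<le> 2 * 0"
    by (intro LIMSEQ_le_const) auto
  then show "E \<mu> t (\<lambda>\<eta>. f (translate k \<eta>)) = E \<mu> t f" by simp
qed

text \<open>Translation invariance at time \<open>1/24\<close> serves as a new initial condition, so the short time interval can be
iterated.\<close>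

lemma translation_invariant_evolve:
  assumes mu: "\<mu> \<in> space (prob_algebra borel)" and inv: "translation_invariant \<mu>" and "0 \<le> t"
  shows "translation_invariant (evolve \<mu> P t)"
proof -
  obtain n :: nat where n: "24 * t \<le> real n"
    using real_arch_simple by blast
  have "translation_invariant (evolve \<mu> P t)" if "0 \<le> t" "24 * t \<le> real n" for t
    using that
  proof (induction n arbitrary: t)
    case 0
    then show ?case using inv by (simp add: evolve_0[OF mu])
  next
    case (Suc n)
    define s where "s = max 0 (t - 1/24)"
    have s: "0 \<le> s" "s \<le> t" "t - s \<le> 1/24" "24 * s \<le> real n"
      using Suc.prems by (auto simp: s_def max_def)
    have "translation_invariant (evolve (evolve \<mu> P s) P (t - s))"
      using s by (intro translation_invariant_evolve_short evolve_prob[OF mu] Suc.IH) auto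
    then show ?case
      using s by (simp add: evolve_add[OF mu])
  qed
  then show ?thesis using n \<open>0 \<le> t\<close> by blast
qed

end

section \<open>Survival of a double hole\<close>

definition double_hole :: "config \<Rightarrow> real" where
  "double_hole \<eta> = of_bool (\<not> \<eta> 0 \<and> \<not> \<eta> 1)"

definition particles :: "nat \<Rightarrow> config \<Rightarrow> int" where
  "particles m \<eta> = (\<Sum>y\<in>{- int m..-1}. of_bool (\<eta> y))"

text \<open>The particles in the window \<open>{- m..-1}\<close> are weighted by their distance from the left end, so that a jump inside
the window or into it from the left raises the total by exactly one.\<close>

definition displacement :: "nat \<Rightarrow> config \<Rightarrow> int" where
  "displacement m \<eta> = (\<Sum>y\<in>{- int m..-1}. (y + int m + 1) * of_bool (\<eta> y))"

text \<open>An upper bound on the number of jumps that the window can still make before the double hole at \<open>{0, 1}\<close> is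
filled. The summand 1 makes the function drop by at least one also when the jump from -1 to 0 fills the
double hole.\<close>

definition remaining_work :: "nat \<Rightarrow> config \<Rightarrow> real" where
  "remaining_work m \<eta> = double_hole \<eta> * of_int (int (m * m) + 1 - displacement m \<eta>)"

text \<open>The double hole together with a window that is not dense enough to guarantee a possible jump.\<close>

definition sparse_double_hole :: "nat \<Rightarrow> config \<Rightarrow> real" where
  "sparse_double_hole m \<eta> = double_hole \<eta> * of_bool (2 * particles m \<eta> < int m + 2)"

lemma double_hole_nonneg: "0 \<le> double_hole \<eta>"
  by (simp add: double_hole_def)

lemma sum_jump:
  fixes c :: "int \<Rightarrow> int"
  assumes "finite A" "\<eta> x" "\<not> \<eta> (x + 1)"
  shows "(\<Sum>y\<in>A. c y * of_bool (exchange x (x + 1) \<eta> y)) =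
    (\<Sum>y\<in>A. c y * of_bool (\<eta> y)) - (if x \<in> A then c x else 0) + (if x + 1 \<in> A then c (x + 1) else 0)"
proof -
  have "c y * of_bool (exchange x (x + 1) \<eta> y) =
      c y * of_bool (\<eta> y) - (if y = x then c y else 0) + (if y = x + 1 then c y else 0)" for y
    using assms(2,3) by (auto simp: exchange_jump)
  then show ?thesis
    using assms(1) by (simp add: sum.distrib sum_subtractf)
qed

lemma displacement_le: "displacement m \<eta> \<le> int (m * m)"
proof -
  have "displacement m \<eta> \<le> of_nat (card {- int m..-1}) * int m"
    unfolding displacement_def by (rule sum_bounded_above) (auto simp: of_bool_def)
  then show ?thesis by simp
qed

lemma remaining_work_nonneg: "0 \<le> remaining_work m \<eta>"
proof -
  have "0 \<le> int (m * m) + 1 - displacement m \<eta>"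
    using displacement_le[of m \<eta>] by linarith
  then show ?thesis
    unfolding remaining_work_def
    by (intro mult_nonneg_nonneg double_hole_nonneg) (rule of_int_0_le_iff[THEN iffD2])
qed

lemma displacement_jump:
  assumes "\<eta> x" "\<not> \<eta> (x + 1)"
  shows "displacement m (exchange x (x + 1) \<eta>) = displacement m \<eta> +
    (if - int m \<le> x + 1 \<and> x < -1 then 1 else if x = -1 \<and> m > 0 then - int m else 0)"
  unfolding displacement_def sum_jump[where c="\<lambda>y. y + int m + 1", OF finite_atLeastAtMost_int assms]
  by auto

lemma particles_jump:
  assumes "\<eta> x" "\<not> \<eta> (x + 1)" "x \<noteq> -1"
  shows "particles m \<eta> \<le> particles m (exchange x (x + 1) \<eta>)"
  unfolding particles_def
  using sum_jump[where c="\<lambda>y. 1" and A="{- int m..-1}" and \<eta>=\<eta> and x=x] assms by auto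

text \<open>A jump from \<open>x\<close> leaves the hole at \<open>x\<close> between particles at \<open>x - 1\<close> and \<open>x + 1\<close>, so it creates no double hole;
a double hole at \<open>{0, 1}\<close> can only be filled from the left, by the jump from -1.\<close>

lemma double_hole_jump:
  assumes "\<eta> (x - 1)" "\<eta> x" "\<not> \<eta> (x + 1)"
  shows "double_hole (exchange x (x + 1) \<eta>) = (if x = -1 then 0 else double_hole \<eta>)"
proof -
  have "exchange x (x + 1) \<eta> y = (if y = x then False else if y = x + 1 then True else \<eta> y)" for y
    by (rule exchange_jump[OF assms(2,3)])
  from this[of 0] this[of 1] show ?thesis
    unfolding double_hole_def using assms by (cases "x = 1") auto
qed

lemma cylinder_double_hole: "cylinder double_hole"
  by (rule cylinder_if_determined_by[of 0 1]) (auto simp: determined_by_def double_hole_def)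

lemma determined_by_particles: "determined_by {- int m..1} (\<lambda>\<eta>. h (double_hole \<eta>) (particles m \<eta>) (displacement m \<eta>))"
  unfolding determined_by_def
proof (intro allI impI)
  fix \<eta> \<xi> :: config assume "\<forall>x\<in>{- int m..1}. \<eta> x = \<xi> x"
  then have "double_hole \<eta> = double_hole \<xi>" "particles m \<eta> = particles m \<xi>"
      "displacement m \<eta> = displacement m \<xi>"
    by (auto simp: double_hole_def particles_def displacement_def intro!: sum.cong)
  then show "h (double_hole \<eta>) (particles m \<eta>) (displacement m \<eta>) =
      h (double_hole \<xi>) (particles m \<xi>) (displacement m \<xi>)" by simp
qed

lemma cylinder_remaining_work: "cylinder (remaining_work m)"
  unfolding remaining_work_def[abs_def]
  by (rule cylinder_if_determined_by,
      rule determined_by_particles[of m "\<lambda>d n w. d * of_int (int (m * m) + 1 - w)"])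

lemma cylinder_sparse_double_hole: "cylinder (sparse_double_hole m)"
  unfolding sparse_double_hole_def[abs_def]
  by (rule cylinder_if_determined_by,
      rule determined_by_particles[of m "\<lambda>d n w. d * of_bool (2 * n < int m + 2)"])

lemma double_hole_gen_nonpos: "ftasep_gen double_hole \<eta> \<le> 0"
proof (rule ftasep_gen_nonpos[OF cylinder_double_hole])
  show "jump_term double_hole \<eta> x \<le> 0" for x
    by (auto simp: jump_term_def double_hole_jump of_bool_def double_hole_nonneg)
qed

text \<open>While the double hole survives nothing leaves the window, so the number of its particles can only
increase.\<close>

lemma sparse_double_hole_gen_nonpos: "ftasep_gen (sparse_double_hole m) \<eta> \<le> 0"
proof (rule ftasep_gen_nonpos[OF cylinder_sparse_double_hole])
  fix x
  have "sparse_double_hole m (exchange x (x + 1) \<eta>) \<le> sparse_double_hole m \<eta>"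
    if j: "\<eta> (x - 1)" "\<eta> x" "\<not> \<eta> (x + 1)"
  proof (cases "x = -1")
    case True
    then show ?thesis
      unfolding sparse_double_hole_def double_hole_jump[OF j] by (simp add: double_hole_nonneg)
  next
    case False
    show ?thesis
      unfolding sparse_double_hole_def double_hole_jump[OF j]
      using particles_jump[where m=m, OF j(2,3) False] False
      by (intro mult_mono) (auto simp: double_hole_nonneg)
  qed
  then show "jump_term (sparse_double_hole m) \<eta> x \<le> 0"
    by (auto simp: jump_term_def of_bool_def)
qed

text \<open>Every jump in the window, the one that fills the double hole included, uses up at least one unit; no jump
gives anything back.\<close>

lemma remaining_work_jump_term:
  "jump_term (remaining_work m) \<eta> x \<le>
    - of_bool (double_hole \<eta> = 1 \<and> \<eta> (x - 1) \<and> \<eta> x \<and> \<not> \<eta> (x + 1) \<and> - int m \<le> x + 1 \<and> x \<le> -1)"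
proof (cases "\<eta> (x - 1) \<and> \<eta> x \<and> \<not> \<eta> (x + 1)")
  case True
  then have j: "\<eta> (x - 1)" "\<eta> x" "\<not> \<eta> (x + 1)" by auto
  let ?C = "int (m * m) + 1"
  have eq: "jump_term (remaining_work m) \<eta> x =
      (if x = -1 then 0 else double_hole \<eta>) * of_int (?C - displacement m (exchange x (x + 1) \<eta>))
      - double_hole \<eta> * of_int (?C - displacement m \<eta>)"
    using j by (simp add: jump_term_def remaining_work_def double_hole_jump[OF j])
  consider "double_hole \<eta> = 0" | "double_hole \<eta> = 1" "x = -1" | "double_hole \<eta> = 1" "x \<noteq> -1"
    by (cases "\<eta> 0 \<or> \<eta> 1") (auto simp: double_hole_def)
  then show ?thesis
  proof cases
    case 1
    then show ?thesis unfolding eq by simp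
  next
    case 2
    have "(1 :: real) \<le> of_int (?C - displacement m \<eta>)"
      using displacement_le[of m \<eta>] by linarith
    then show ?thesis
      unfolding eq using 2 by (simp only: of_bool_def if_True) (auto split: if_splits)
  next
    case 3
    then show ?thesis
      unfolding eq displacement_jump[OF j(2,3)] by simp
  qed
qed (auto simp: jump_term_def)

lemma particles_Suc: "particles (Suc m) \<eta> = of_bool (\<eta> (- int (Suc m))) + particles m \<eta>"
proof -
  have "{- int (Suc m)..-1} = insert (- int (Suc m)) {- int m..-1}" by auto
  then show ?thesis by (simp add: particles_def)
qed

lemma particles_without_pairs:
  assumes "\<And>y. - int m \<le> y \<Longrightarrow> y < -1 \<Longrightarrow> \<not> (\<eta> y \<and> \<eta> (y + 1))"
  shows "2 * particles m \<eta> \<le> int m + 1"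
  using assms
proof (induction m rule: induct_nat_012)
  case 0
  then show ?case by (simp add: particles_def)
next
  case 1
  then show ?case using particles_Suc[of 0 \<eta>] by (simp add: particles_def)
next
  case (ge2 m)
  have "2 * particles m \<eta> \<le> int m + 1"
    using ge2.prems by (intro ge2.IH(1)) auto
  moreover have "\<not> (\<eta> (- int (Suc (Suc m))) \<and> \<eta> (- int (Suc m)))"
    using ge2.prems[of "- int (Suc (Suc m))"] by auto
  ultimately show ?case
    unfolding particles_Suc[of "Suc m"] particles_Suc[of m] by (auto simp: of_bool_def)
qed

text \<open>More than \<open>(m + 1) / 2\<close> particles do not fit into \<open>m\<close> sites without two neighbours; to the right of the last such
pair comes a hole, at 0 at the latest, so the right particle of the pair can jump.\<close>

lemma active_particle_in_window:
  assumes "\<not> \<eta> 0" "int m + 2 \<le> 2 * particles m \<eta>"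
  obtains x where "- int m \<le> x + 1" "x \<le> -1" "\<eta> (x - 1)" "\<eta> x" "\<not> \<eta> (x + 1)"
proof -
  define S where "S = {y \<in> {- int m..-2}. \<eta> y \<and> \<eta> (y + 1)}"
  have "finite S" unfolding S_def by (rule finite_subset[of _ "{- int m..-2}"]) auto
  moreover have "S \<noteq> {}"
  proof
    assume "S = {}"
    then have "2 * particles m \<eta> \<le> int m + 1"
      by (intro particles_without_pairs) (auto simp: S_def)
    then show False using assms(2) by simp
  qed
  ultimately have max: "Max S \<in> S" "\<And>y. y \<in> S \<Longrightarrow> y \<le> Max S"
    by auto
  have "\<not> \<eta> (Max S + 2)"
  proof (cases "Max S = -2")
    case False
    then have "Max S + 1 \<in> {- int m..-2}" using max(1) by (auto simp: S_def)
    moreover have "Max S + 1 \<notin> S" using max(2)[of "Max S + 1"] by auto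
    ultimately show ?thesis using max(1) by (auto simp: S_def add.assoc)
  qed (use assms(1) in simp)
  with max(1) show thesis
    by (intro that[of "Max S + 1"]) (auto simp: S_def add.assoc)
qed

text \<open>In a dense window next to a double hole some jump is always possible, and each possible jump has rate one.\<close>

lemma remaining_work_gen_le:
  "ftasep_gen (remaining_work m) \<eta> \<le> sparse_double_hole m \<eta> - double_hole \<eta>"
proof -
  have "jump_term (remaining_work m) \<eta> x \<le> 0" for x
    by (rule order_trans[OF remaining_work_jump_term]) simp
  then have le: "ftasep_gen (remaining_work m) \<eta> \<le> jump_term (remaining_work m) \<eta> x" for x
    by (rule ftasep_gen_le_term[OF cylinder_remaining_work])
  have dh: "double_hole \<eta> = 0 \<or> double_hole \<eta> = 1 \<and> \<not> \<eta> 0" by (auto simp: double_hole_def)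
  show ?thesis
  proof (cases "double_hole \<eta> = 1 \<and> int m + 2 \<le> 2 * particles m \<eta>")
    case True
    then obtain x where "- int m \<le> x + 1" "x \<le> -1" "\<eta> (x - 1)" "\<eta> x" "\<not> \<eta> (x + 1)"
      using active_particle_in_window[of \<eta> m] dh by auto
    then have "ftasep_gen (remaining_work m) \<eta> \<le> -1"
      using le[of x] remaining_work_jump_term[of m \<eta> x] True by simp
    then show ?thesis
      using True by (simp add: sparse_double_hole_def)
  next
    case False
    then have "sparse_double_hole m \<eta> - double_hole \<eta> = 0"
      using dh by (auto simp: sparse_double_hole_def)
    moreover have "ftasep_gen (remaining_work m) \<eta> \<le> 0"
      using le[of 0] remaining_work_jump_term[of m \<eta> 0] by simp
    ultimately show ?thesis by simp
  qed
qed

context ftasep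
begin

lemma integral_cylinder_nonpos:
  assumes "\<mu> \<in> space (prob_algebra borel)" "cylinder f" "\<And>\<eta>. f \<eta> \<le> 0"
  shows "(\<integral>\<eta>. f \<eta> \<partial>\<mu>) \<le> 0"
proof -
  have "0 \<le> (\<integral>\<eta>. - f \<eta> \<partial>\<mu>)"
    using assms(3) by (intro integral_nonneg_AE) auto
  then show ?thesis by simp
qed

text \<open>Started from a dense window the window stays dense as long as the double hole lasts, so the work left
decreases at least at the rate of the survival probability. Since that probability is nonincreasing in time,
its value at \<open>T\<close> times \<open>T\<close> is at most the initial amount of work. Both monotonicities are combined in the
single nonincreasing quantity \<open>\<psi>\<close>.\<close>

lemma double_hole_survival:
  assumes dense: "int m + 2 \<le> 2 * particles m \<eta>" and "0 \<le> T"
  shows "T * (\<integral>\<xi>. double_hole \<xi> \<partial>P T \<eta>) \<le> remaining_work m \<eta>"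
proof -
  define \<mu> where "\<mu> = return borel \<eta>"
  have mu: "\<mu> \<in> space (prob_algebra borel)" by (simp add: \<mu>_def return_prob_algebra)
  have E0: "E \<mu> 0 f = f \<eta>" if "cylinder f" for f
    unfolding evolve_0[OF mu] by (simp add: \<mu>_def integral_return cylinder_measurable[OF that])
  have sparse: "E \<mu> t (sparse_double_hole m) \<le> 0" if "0 \<le> t" for t
  proof -
    have "E \<mu> t (sparse_double_hole m) \<le> E \<mu> 0 (sparse_double_hole m)"
      by (rule nonincreasing_if_derivative_nonpos[OF kolmogorov_forward[OF cylinder_sparse_double_hole mu] _ that])
         (auto intro!: integral_cylinder_nonpos evolve_prob[OF mu] cylinder_ftasep_gen
           cylinder_sparse_double_hole sparse_double_hole_gen_nonpos)
    also have "\<dots> = 0"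
      using dense by (simp only: E0 cylinder_sparse_double_hole) (simp add: sparse_double_hole_def)
    finally show ?thesis .
  qed
  define \<psi> where "\<psi> t = E \<mu> t (remaining_work m) + t * E \<mu> t double_hole" for t
  have "\<psi> T \<le> \<psi> 0"
  proof (rule nonincreasing_if_derivative_nonpos[OF _ _ \<open>0 \<le> T\<close>])
    fix t :: real assume "0 \<le> t"
    note prob = evolve_prob[OF mu \<open>0 \<le> t\<close>]
    show "(\<psi> has_real_derivative E \<mu> t (ftasep_gen (remaining_work m)) +
        (E \<mu> t double_hole + t * E \<mu> t (ftasep_gen double_hole))) (at t within {0..})"
      unfolding \<psi>_def
      using kolmogorov_forward[OF cylinder_remaining_work mu \<open>0 \<le> t\<close>]
        kolmogorov_forward[OF cylinder_double_hole mu \<open>0 \<le> t\<close>]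
      by (auto intro!: derivative_eq_intros)
    have "E \<mu> t (ftasep_gen (remaining_work m)) \<le> E \<mu> t (\<lambda>\<eta>. sparse_double_hole m \<eta> - double_hole \<eta>)"
      using integrable_cylinder[OF prob cylinder_sparse_double_hole]
        integrable_cylinder[OF prob cylinder_double_hole]
        integrable_cylinder[OF prob cylinder_ftasep_gen[OF cylinder_remaining_work]]
      by (intro integral_mono remaining_work_gen_le) auto
    also have "\<dots> = E \<mu> t (sparse_double_hole m) - E \<mu> t double_hole"
      using integrable_cylinder[OF prob cylinder_sparse_double_hole]
        integrable_cylinder[OF prob cylinder_double_hole] by simp
    also have "\<dots> \<le> - E \<mu> t double_hole" using sparse[OF \<open>0 \<le> t\<close>] by simp
    finally have "E \<mu> t (ftasep_gen (remaining_work m)) + E \<mu> t double_hole \<le> 0" by simp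
    moreover have "t * E \<mu> t (ftasep_gen double_hole) \<le> 0"
      using \<open>0 \<le> t\<close> by (intro mult_nonneg_nonpos integral_cylinder_nonpos[OF prob]
          cylinder_ftasep_gen cylinder_double_hole double_hole_gen_nonpos)
    ultimately show "E \<mu> t (ftasep_gen (remaining_work m)) +
        (E \<mu> t double_hole + t * E \<mu> t (ftasep_gen double_hole)) \<le> 0" by simp
  qed
  moreover have "\<psi> 0 = remaining_work m \<eta>"
    by (simp add: \<psi>_def E0 cylinder_remaining_work)
  moreover have "E \<mu> T (remaining_work m) \<ge> 0"
    by (intro integral_nonneg_AE AE_I2 remaining_work_nonneg)
  ultimately have "T * E \<mu> T double_hole \<le> remaining_work m \<eta>"
    by (simp add: \<psi>_def)
  then show ?thesis by (simp add: \<mu>_def evolve_return \<open>0 \<le> T\<close>)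
qed

end

section \<open>The fair product measure\<close>

abbreviation fair_product :: "config measure" where
  "fair_product \<equiv> bernoulli_product (1/2)"

lemma sets_bernoulli_product [measurable_cong]: "sets (bernoulli_product \<rho>) = sets borel"
  using bernoulli_product_prob by (simp add: space_prob_algebra)

lemma coordinate_measurable [measurable]: "Measurable.pred borel (\<lambda>\<eta>::config. \<eta> x)"
proof -
  have "(\<lambda>\<eta>::config. \<eta> x) \<in> borel \<rightarrow>\<^sub>M (borel :: bool measure)"
    by (rule measurable_product_coordinates)
  also have "borel \<rightarrow>\<^sub>M (borel :: bool measure) = borel \<rightarrow>\<^sub>M count_space UNIV"
    by (intro measurable_cong_sets) (auto simp: sets_borel_eq_count_space)
  finally show ?thesis .
qed

text \<open>The law is invariant under tossing the coin at one site anew. In this form independence can be used for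
functions of the whole configuration.\<close>

lemma integral_fair_product_resample:
  fixes F :: "config \<Rightarrow> real"
  assumes F: "F \<in> borel_measurable borel" and M: "\<And>\<eta>. \<bar>F \<eta>\<bar> \<le> M"
  shows "(\<integral>\<eta>. F \<eta> \<partial>fair_product) =
    ((\<integral>\<eta>. F (\<eta>(x := True)) \<partial>fair_product) + (\<integral>\<eta>. F (\<eta>(x := False)) \<partial>fair_product)) / 2"
proof -
  define B where "B = measure_pmf (bernoulli_pmf (1/2))"
  define R where "R = Pi\<^sub>M (UNIV - {x}) (\<lambda>_::int. B)"
  interpret B: prob_space B unfolding B_def by (rule prob_space_measure_pmf)
  interpret R: prob_space R unfolding R_def by (rule prob_space_PiM) (rule B.prob_space_axioms)
  interpret pair: pair_prob_space B R ..
  have ins: "insert x (UNIV - {x}) = UNIV" by auto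
  have upd: "(\<lambda>(b, X). X(x := b)) \<in> B \<Otimes>\<^sub>M R \<rightarrow>\<^sub>M fair_product"
  proof -
    have "(\<lambda>(b, X). X(x := b)) \<in> B \<Otimes>\<^sub>M R \<rightarrow>\<^sub>M Pi\<^sub>M (insert x (UNIV - {x})) (\<lambda>_::int. B)"
      unfolding R_def by measurable
    then show ?thesis by (simp add: ins bernoulli_product_def B_def)
  qed
  have "distr (B \<Otimes>\<^sub>M R) fair_product (\<lambda>(b, X). X(x := b)) = fair_product"
    using distr_pair_PiM_eq_PiM[of "UNIV - {x}" "\<lambda>_. B" x] B.prob_space_axioms
    unfolding ins by (simp add: bernoulli_product_def R_def B_def)
  then have split: "(\<integral>\<eta>. G \<eta> \<partial>fair_product) =
      ((\<integral>X. G (X(x := True)) \<partial>R) + (\<integral>X. G (X(x := False)) \<partial>R)) / 2"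
    if G: "G \<in> borel_measurable borel" "\<And>\<eta>. \<bar>G \<eta>\<bar> \<le> M" for G :: "config \<Rightarrow> real"
  proof -
    have G': "G \<in> borel_measurable fair_product" using G(1) by measurable
    have "(\<integral>\<eta>. G \<eta> \<partial>fair_product) = (\<integral>p. (case p of (b, X) \<Rightarrow> G (X(x := b))) \<partial>(B \<Otimes>\<^sub>M R))"
      using integral_distr[OF upd G'] \<open>distr (B \<Otimes>\<^sub>M R) _ _ = _\<close> by (simp add: case_prod_unfold)
    also have "\<dots> = (\<integral>b. \<integral>X. G (X(x := b)) \<partial>R \<partial>B)"
    proof (rule pair.integral_fst'[of "\<lambda>(b, X). G (X(x := b))", simplified, symmetric])
      show "integrable (B \<Otimes>\<^sub>M R) (\<lambda>(b, X). G (X(x := b)))"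
        using G(2) measurable_compose[OF upd G']
        by (intro pair.integrable_const_bound[of _ M]) (auto simp: case_prod_unfold)
    qed
    also have "\<dots> = ((\<integral>X. G (X(x := True)) \<partial>R) + (\<integral>X. G (X(x := False)) \<partial>R)) / 2"
      unfolding B_def by simp
    finally show ?thesis .
  qed
  have "(\<integral>\<eta>. F (\<eta>(x := b)) \<partial>fair_product) = (\<integral>X. F (X(x := b)) \<partial>R)" for b
  proof -
    have "(\<lambda>\<eta>::config. \<eta>(x := b)) \<in> borel \<rightarrow>\<^sub>M borel"
      by (rule measurable_coordinatewise_then_product) (simp add: fun_upd_def)
    then have "(\<lambda>\<eta>. F (\<eta>(x := b))) \<in> borel_measurable borel"
      using F by measurable
    from split[OF this M] show ?thesis by simp
  qed
  then show ?thesis using split[OF F M] by simp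
qed

lemma translation_invariant_bernoulli_product:
  fixes f :: "config \<Rightarrow> real"
  assumes "f \<in> borel_measurable borel"
  shows "(\<integral>\<eta>. f (translate k \<eta>) \<partial>bernoulli_product \<rho>) = (\<integral>\<eta>. f \<eta> \<partial>bernoulli_product \<rho>)"
proof -
  have m: "translate k \<in> bernoulli_product \<rho> \<rightarrow>\<^sub>M bernoulli_product \<rho>"
  proof -
    have "translate k \<in> borel \<rightarrow>\<^sub>M borel"
      by (rule measurable_coordinatewise_then_product) (simp add: translate_def)
    then show ?thesis by measurable
  qed
  have "distr (bernoulli_product \<rho>) (bernoulli_product \<rho>) (translate k) = bernoulli_product \<rho>"
    using distr_PiM_reindex[of UNIV "\<lambda>_::int. measure_pmf (bernoulli_pmf \<rho>)" "\<lambda>x. x + k" UNIV]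
    by (simp add: bernoulli_product_def translate_def[abs_def] prob_space_measure_pmf inj_def restrict_UNIV)
  then show ?thesis
    using integral_distr[OF m, of f] assms by (simp cong: measurable_cong_sets)
qed

section \<open>Recurrence of the symmetric random walk\<close>

text \<open>Reading the sites \<open>x\<close>, \<open>x - 1\<close>, ... as steps of a walk that goes up on particles and down on holes,
\<open>avoids n k x \<eta>\<close> says that the walk does not rise to level \<open>k\<close> within \<open>n\<close> steps. The recursion is over
the first step, after which the level is \<open>k - 1\<close> or \<open>k + 1\<close> away.\<close>

fun avoids :: "nat \<Rightarrow> nat \<Rightarrow> int \<Rightarrow> config \<Rightarrow> bool" where
  "avoids n 0 x \<eta> = False"
| "avoids 0 (Suc k) x \<eta> = True"
| "avoids (Suc n) (Suc k) x \<eta> =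
    (if \<eta> x then avoids n k (x - 1) \<eta> else avoids n (Suc (Suc k)) (x - 1) \<eta>)"

fun avoid_prob :: "nat \<Rightarrow> nat \<Rightarrow> real" where
  "avoid_prob n 0 = 0"
| "avoid_prob 0 (Suc k) = 1"
| "avoid_prob (Suc n) (Suc k) = (avoid_prob n k + avoid_prob n (Suc (Suc k))) / 2"

lemma avoids_fun_upd: "x < y \<Longrightarrow> avoids n k x (\<eta>(y := b)) = avoids n k x \<eta>"
  by (induction n k x \<eta> rule: avoids.induct) auto

lemma avoids_measurable [measurable]: "Measurable.pred borel (avoids n k x)"
proof (induction n arbitrary: k x)
  case 0
  then show ?case by (cases k) simp_all
next
  case (Suc n)
  note Suc.IH [measurable]
  show ?case by (cases k) simp_all
qed

lemma integral_avoids: "(\<integral>\<eta>. of_bool (avoids n k x \<eta>) \<partial>fair_product) = avoid_prob n k"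
proof (induction n k arbitrary: x rule: avoid_prob.induct)
  case (2 k)
  interpret prob_space fair_product using bernoulli_product_prob by (simp add: space_prob_algebra)
  show ?case by (simp add: prob_space)
next
  case (3 n k)
  have "(\<lambda>\<eta>. of_bool (avoids (Suc n) (Suc k) x \<eta>) :: real) \<in> borel_measurable borel"
    by measurable
  from integral_fair_product_resample[OF this, of 1 x] show ?case
    by (simp add: avoids_fun_upd 3)
qed simp

text \<open>After \<open>m\<close> steps the height of the walk is the number of particles minus the number of holes that it has
read.\<close>

lemma reaches_level_if_not_avoids:
  "\<not> avoids n k x \<eta> \<Longrightarrow> \<exists>m. 2 * (\<Sum>y\<in>{x - int m + 1..x}. of_bool (\<eta> y)) = int m + int k"
proof (induction n k x \<eta> rule: avoids.induct)
  case (1 n x \<eta>)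
  then show ?case by (intro exI[of _ 0]) simp
next
  case (3 n k x \<eta>)
  obtain m where m: "2 * (\<Sum>y\<in>{x - 1 - int m + 1..x - 1}. of_bool (\<eta> y)) =
      int m + int (if \<eta> x then k else Suc (Suc k))"
    using 3 by (cases "\<eta> x") auto
  have "{x - int (Suc m) + 1..x} = insert x {x - 1 - int m + 1..x - 1}" by auto
  then show ?case using m by (intro exI[of _ "Suc m"]) (auto split: if_splits)
qed simp

lemma avoid_prob_bounds: "0 \<le> avoid_prob n k" "avoid_prob n k \<le> 1"
  by (induction n k rule: avoid_prob.induct) auto

lemma avoid_prob_Suc_le: "avoid_prob (Suc n) k \<le> avoid_prob n k"
proof (induction n k rule: avoid_prob.induct)
  case (2 k)
  show ?case by (rule order_trans[OF avoid_prob_bounds(2)]) simp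
next
  case (3 n k)
  then show ?case
    unfolding avoid_prob.simps(3)[of _ k] by (intro divide_right_mono add_mono) auto
qed simp

text \<open>The limit in \<open>n\<close> exists by monotonicity and is harmonic in \<open>k\<close> with value 0 at 0, hence linear in \<open>k\<close>;
a bounded linear function vanishes.\<close>

lemma avoid_prob_tendsto_0: "(\<lambda>n. avoid_prob n k) \<longlonglongrightarrow> 0"
proof -
  define q where "q k = lim (\<lambda>n. avoid_prob n k)" for k
  have "convergent (\<lambda>n. avoid_prob n k)" for k
  proof -
    have "decseq (\<lambda>n. avoid_prob n k)"
      by (rule decseq_SucI) (rule avoid_prob_Suc_le)
    moreover have "\<forall>n. 0 \<le> avoid_prob n k"
      by (intro allI avoid_prob_bounds)
    ultimately obtain L where "(\<lambda>n. avoid_prob n k) \<longlonglongrightarrow> L"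
      by (rule decseq_convergent)
    then show ?thesis by (rule convergentI)
  qed
  then have q: "(\<lambda>n. avoid_prob n k) \<longlonglongrightarrow> q k" for k
    unfolding q_def by (rule convergent_LIMSEQ_iff[THEN iffD1])
  have q0: "q 0 = 0"
    by (rule LIMSEQ_unique[OF q]) simp
  have q_nonneg: "0 \<le> q k" for k
    by (rule LIMSEQ_le_const[OF q]) (simp add: avoid_prob_bounds)
  have q_le_1: "q k \<le> 1" for k
    by (rule LIMSEQ_le_const2[OF q]) (simp add: avoid_prob_bounds)
  have step: "q (Suc k) = (q k + q (Suc (Suc k))) / 2" for k
  proof (rule LIMSEQ_unique)
    show "(\<lambda>n. avoid_prob (Suc n) (Suc k)) \<longlonglongrightarrow> q (Suc k)"
      by (rule LIMSEQ_Suc[OF q])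
    show "(\<lambda>n. avoid_prob (Suc n) (Suc k)) \<longlonglongrightarrow> (q k + q (Suc (Suc k))) / 2"
      unfolding avoid_prob.simps by (intro tendsto_intros q) simp
  qed
  have linear: "q k = real k * q 1" for k
  proof (induction k rule: induct_nat_012)
    case (ge2 k)
    have "q (Suc (Suc k)) = 2 * q (Suc k) - q k" using step[of k] by (simp add: field_simps)
    also have "\<dots> = real (Suc (Suc k)) * q 1" unfolding ge2 by (simp add: algebra_simps)
    finally show ?case .
  qed (simp_all add: q0 del: One_nat_def, simp)
  have "q 1 = 0"
  proof (rule ccontr)
    assume "q 1 \<noteq> 0"
    then have "q 1 > 0" using q_nonneg[of 1] by linarith
    then obtain k :: nat where "1 < real k * q 1"
      using reals_Archimedean3 by blast
    then show False using q_le_1[of k] linear[of k] by linarith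
  qed
  then have "q k = 0" using linear[of k] by (simp only: mult_zero_right)
  then show ?thesis using q[of k] by (simp only:)
qed

text \<open>Level 2 for the walk that starts at -1 is exactly the density that
\<open>double_hole_survival\<close> asks for.\<close>

lemma AE_dense_window: "AE \<eta> in fair_product. \<exists>m. int m + 2 \<le> 2 * particles m \<eta>"
proof -
  interpret prob_space fair_product using bernoulli_product_prob by (simp add: space_prob_algebra)
  define S where "S = {\<eta> \<in> space fair_product. \<forall>n. avoids n 2 (-1) \<eta>}"
  have S: "S \<in> sets fair_product" unfolding S_def by measurable
  have "prob S \<le> avoid_prob n 2" for n
  proof -
    have "{\<eta> \<in> space fair_product. avoids n 2 (-1) \<eta>} \<in> sets fair_product" by measurable
    moreover from this have "avoid_prob n 2 = prob {\<eta> \<in> space fair_product. avoids n 2 (-1) \<eta>}"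
      unfolding integral_avoids[symmetric, of n 2 "-1"]
      by (subst Bochner_Integration.integral_cong[OF refl,
            where g="indicator {\<eta> \<in> space fair_product. avoids n 2 (-1) \<eta>}"])
         (auto simp: indicator_def)
    ultimately show ?thesis
      by (auto intro!: finite_measure_mono simp: S_def)
  qed
  then have "prob S \<le> 0"
    by (intro LIMSEQ_le_const[OF avoid_prob_tendsto_0]) auto
  then have "prob S = 0" by (simp add: measure_le_0_iff)
  then have "AE \<eta> in fair_product. \<eta> \<notin> S"
    using S by (simp add: AE_iff_measurable[OF S] emeasure_eq_measure S_def cong: conj_cong)
  then show ?thesis
  proof (rule AE_mp, intro AE_I2 impI)
    fix \<eta> assume "\<eta> \<in> space fair_product" "\<eta> \<notin> S"
    then obtain n where "\<not> avoids n 2 (-1) \<eta>" by (auto simp: S_def)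
    from reaches_level_if_not_avoids[OF this]
    show "\<exists>m. int m + 2 \<le> 2 * particles m \<eta>"
      by (auto simp: particles_def) (metis order_refl add.commute)
  qed
qed

section \<open>Test functions and the limit law\<close>

text \<open>A basic open set of the product topology restricts only finitely many coordinates.\<close>

lemma continuous_config_oscillation:
  fixes f :: "config \<Rightarrow> real"
  assumes "continuous_on UNIV f" "0 < \<epsilon>"
  obtains N :: nat where "\<And>\<eta>. (\<And>x. \<bar>x\<bar> \<le> int N \<Longrightarrow> \<eta> x = \<xi> x) \<Longrightarrow> \<bar>f \<eta> - f \<xi>\<bar> < \<epsilon>"
proof -
  define U where "U = {\<eta>. \<bar>f \<eta> - f \<xi>\<bar> < \<epsilon>}"
  have "open U"
    unfolding U_def by (intro open_Collect_less continuous_intros assms(1))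
  then have "openin (product_topology (\<lambda>_. euclidean) UNIV) U"
    by (simp add: open_fun_def)
  moreover have "\<xi> \<in> U" using assms(2) by (simp add: U_def)
  ultimately obtain X where X: "\<xi> \<in> Pi\<^sub>E UNIV X" "finite {x. X x \<noteq> UNIV}" "Pi\<^sub>E UNIV X \<subseteq> U"
    using product_topology_open_contains_basis[of "\<lambda>_. euclidean" UNIV U \<xi>] by auto
  define N where "N = nat (Max (insert 0 (abs ` {x. X x \<noteq> UNIV})))"
  have N: "\<bar>x\<bar> \<le> int N" if "X x \<noteq> UNIV" for x
  proof -
    have "\<bar>x\<bar> \<le> Max (insert 0 (abs ` {x. X x \<noteq> UNIV}))"
      using X(2) that by (intro Max_ge) auto
    then show ?thesis unfolding N_def by linarith
  qed
  have "\<bar>f \<eta> - f \<xi>\<bar> < \<epsilon>" if eq: "\<And>x. \<bar>x\<bar> \<le> int N \<Longrightarrow> \<eta> x = \<xi> x" for \<eta>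
  proof -
    have "\<eta> x \<in> X x" for x
    proof (cases "X x = UNIV")
      case False
      then have "\<eta> x = \<xi> x" using N eq by blast
      then show ?thesis using X(1) by auto
    qed simp
    then have "\<eta> \<in> U" using X(3) by auto
    then show ?thesis by (simp add: U_def)
  qed
  then show thesis using that by blast
qed

lemma alternating_on_window:
  assumes "\<And>x. - int N \<le> x \<Longrightarrow> x < int N \<Longrightarrow> \<eta> x \<noteq> \<eta> (x + 1)" "\<bar>x\<bar> \<le> int N"
  shows "\<eta> x = (if \<eta> 0 then alt0 x else alt1 x)"
proof -
  have "\<bar>x\<bar> \<le> int N \<longrightarrow> \<eta> x = (\<eta> 0 = even x)"
  proof (induction x rule: int_induct[of _ 0])
    case (step1 x)
    then show ?case using assms(1)[of x] by auto
  next
    case (step2 x)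
    then show ?case using assms(1)[of "x - 1"] by auto
  qed simp
  then show ?thesis using assms(2) by (auto simp: alt0_def alt1_def)
qed

text \<open>The mixture is the image of a fair coin.\<close>

lemma integral_alternating_mixture:
  assumes "f \<in> borel_measurable borel"
  shows "(\<integral>\<xi>. f \<xi> \<partial>alternating_mixture) = (f alt1 + f alt0 :: real) / 2"
proof -
  let ?B = "measure_pmf (bernoulli_pmf (1/2))"
  let ?h = "\<lambda>b. if b then alt1 else alt0"
  have h: "?h \<in> ?B \<rightarrow>\<^sub>M borel" by simp
  have "alternating_mixture = distr ?B borel ?h"
  proof (rule measure_eqI)
    show "sets alternating_mixture = sets (distr ?B borel ?h)"
      by (simp add: sets_alternating_mixture)
    fix A assume "A \<in> sets alternating_mixture"
    then have A: "A \<in> sets borel" by (simp add: sets_alternating_mixture)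
    have "emeasure (distr ?B borel ?h) A = (\<integral>\<^sup>+b. indicator A (?h b) \<partial>?B)"
    proof -
      have "emeasure (distr ?B borel ?h) A = (\<integral>\<^sup>+\<xi>. indicator A \<xi> \<partial>distr ?B borel ?h)"
        using A by simp
      also have "\<dots> = (\<integral>\<^sup>+b. indicator A (?h b) \<partial>?B)"
        using A by (intro nn_integral_distr[OF h]) simp
      finally show ?thesis .
    qed
    also have "\<dots> = 1/2 * indicator A alt1 + 1/2 * indicator A alt0"
      by (simp add: mult.commute divide_ennreal_def)
    also have "\<dots> = emeasure alternating_mixture A"
      using A by (simp add: emeasure_alternating_mixture)
    finally show "emeasure alternating_mixture A = emeasure (distr ?B borel ?h) A" by simp
  qed
  then show ?thesis
    using integral_distr[OF h assms] by (simp add: field_simps)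
qed

section \<open>Density and vanishing of equal neighbours\<close>

lemma cylinder_coordinate: "cylinder (\<lambda>\<eta>. of_bool (\<eta> x))"
  by (rule cylinder_if_determined_by[of x x]) (simp add: determined_by_def)

context ftasep
begin

lemma translation_invariant_fair_product: "translation_invariant fair_product"
  by (simp add: translation_invariant_def translation_invariant_bernoulli_product cylinder_measurable)

text \<open>The generator applied to the occupation of a site is the difference of the currents across its two
bonds, and these have the same expectation by translation invariance.\<close>

lemma density_half:
  assumes "0 \<le> t"
  shows "E fair_product t (\<lambda>\<eta>. of_bool (\<eta> x)) = 1/2"
proof -
  note mu = bernoulli_product_prob[of "1/2"]
  have inv: "translation_invariant (evolve fair_product P t)" if "0 \<le> t" for t
    by (rule translation_invariant_evolve[OF mu translation_invariant_fair_product that])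
  define f :: "config \<Rightarrow> real" where "f \<eta> = of_bool (\<eta> 0)" for \<eta>
  define g :: "config \<Rightarrow> real" where "g \<eta> = of_bool (\<eta> (-1) \<and> \<eta> 0 \<and> \<not> \<eta> 1)" for \<eta>
  have f: "cylinder f" unfolding f_def[abs_def] by (rule cylinder_coordinate)
  have g: "cylinder g"
    by (rule cylinder_if_determined_by[of "-1" 1]) (auto simp: determined_by_def g_def)
  have "ftasep_gen f \<eta> = g (translate (-1) \<eta>) - g \<eta>" for \<eta>
  proof -
    have "determined_by {0..0} f" by (simp add: determined_by_def f_def)
    from ftasep_gen_eq_sum[OF this]
    have "ftasep_gen f \<eta> = (\<Sum>x\<in>{-1..0}. jump_term f \<eta> x)" by simp
    also have "{-1..0} = {-1, 0 :: int}" by auto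
    finally have "ftasep_gen f \<eta> = jump_term f \<eta> (-1) + jump_term f \<eta> 0" by simp
    then show ?thesis
      by (auto simp: jump_term_def f_def g_def translate_def exchange_def)
  qed
  then have "E fair_product t (ftasep_gen f) = 0" if "0 \<le> t" for t
    using translation_invariantD[OF inv[OF that] g, of "-1"]
      integrable_evolve_cylinder[OF mu that g]
      integrable_evolve_cylinder[OF mu that cylinder_translate[OF g, of "-1"]]
    by simp
  then have "E fair_product t f = E fair_product 0 f"
    using kolmogorov_forward[OF f mu] \<open>0 \<le> t\<close>
    by (intro const_if_derivative_0) auto
  also have "\<dots> = 1/2"
  proof -
    interpret prob_space fair_product using mu by (simp add: space_prob_algebra)
    show ?thesis
      using integral_fair_product_resample[OF cylinder_measurable[OF f], of 1 0]
      by (simp add: evolve_0[OF mu] f_def prob_space)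
  qed
  also have "E fair_product t f = E fair_product t (\<lambda>\<eta>. f (translate x \<eta>))"
    using translation_invariantD[OF inv[OF \<open>0 \<le> t\<close>] f] by simp
  finally show ?thesis by (simp add: f_def translate_def)
qed

text \<open>At density 1/2 double particles are exactly as likely as double holes, since the difference of their
indicators is \<open>\<eta> 0 + \<eta> 1 - 1\<close>.\<close>

lemma equal_neighbours:
  assumes "0 \<le> t"
  shows "E fair_product t (\<lambda>\<eta>. of_bool (\<eta> x = \<eta> (x + 1))) = 2 * E fair_product t double_hole"
proof -
  note mu = bernoulli_product_prob[of "1/2"]
  define f :: "config \<Rightarrow> real" where "f \<eta> = of_bool (\<eta> 0 = \<eta> 1)" for \<eta>
  have f: "cylinder f"
    by (rule cylinder_if_determined_by[of 0 1]) (auto simp: determined_by_def f_def)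
  have "f \<eta> = 2 * double_hole \<eta> + of_bool (\<eta> 0) + of_bool (\<eta> 1) - 1" for \<eta>
    by (auto simp: f_def double_hole_def)
  then have f_eq: "f = (\<lambda>\<eta>. 2 * double_hole \<eta> + of_bool (\<eta> 0) + of_bool (\<eta> 1) - 1)" by blast
  interpret prob_space "evolve fair_product P t"
    using evolve_prob[OF mu assms] by (simp add: space_prob_algebra)
  have "E fair_product t f = 2 * E fair_product t double_hole"
    unfolding f_eq
    using integrable_evolve_cylinder[OF mu assms cylinder_double_hole]
      integrable_evolve_cylinder[OF mu assms cylinder_coordinate, of 0]
      integrable_evolve_cylinder[OF mu assms cylinder_coordinate, of 1]
      density_half[OF assms, of 0] density_half[OF assms, of 1]
    by (simp add: prob_space)
  moreover have "E fair_product t (\<lambda>\<eta>. f (translate x \<eta>)) = E fair_product t f"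
    by (rule translation_invariantD[OF translation_invariant_evolve[OF mu
          translation_invariant_fair_product assms] f])
  ultimately show ?thesis by (simp add: f_def translate_def add.commute)
qed

lemma double_hole_vanishes: "((\<lambda>t. E fair_product t double_hole) \<longlongrightarrow> 0) at_top"
proof -
  note mu = bernoulli_product_prob[of "1/2"]
  interpret prob_space fair_product using mu by (simp add: space_prob_algebra)
  have bound: "\<bar>double_hole \<eta>\<bar> \<le> 1" for \<eta> by (simp add: double_hole_def)
  \<comment> \<open>The measures \<open>P t \<eta>\<close> are meaningful for \<open>0 \<le> t\<close> only, but dominated convergence asks for measurability at every \<open>t\<close>.\<close>
  define s where "s t \<eta> = (\<integral>\<xi>. double_hole \<xi> \<partial>P (max 0 t) \<eta>)" for t \<eta>
  have "((\<lambda>t. \<integral>\<eta>. s t \<eta> \<partial>fair_product) \<longlongrightarrow> (\<integral>\<eta>. 0 \<partial>fair_product)) at_top"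
  proof (rule integral_dominated_convergence_at_top[where w="\<lambda>_. 1"])
    show "s t \<in> borel_measurable fair_product" for t
      using kernel_integral_measurable[OF cylinder_double_hole, of "max 0 t"]
      by (simp add: s_def[abs_def] cong: measurable_cong_sets)
    show "\<forall>\<^sub>F t in at_top. AE \<eta> in fair_product. norm (s t \<eta>) \<le> 1"
      using abs_integral_le[OF kernel_prob bound] by (simp add: s_def)
    show "AE \<eta> in fair_product. ((\<lambda>t. s t \<eta>) \<longlongrightarrow> 0) at_top"
      using AE_dense_window
    proof (rule AE_mp, intro AE_I2 impI)
      fix \<eta> assume "\<exists>m. int m + 2 \<le> 2 * particles m \<eta>"
      then obtain m where m: "int m + 2 \<le> 2 * particles m \<eta>" by blast
      show "((\<lambda>t. s t \<eta>) \<longlongrightarrow> 0) at_top"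
      proof (rule tendsto_sandwich[OF _ _ tendsto_const])
        show "\<forall>\<^sub>F t in at_top. 0 \<le> s t \<eta>"
          by (simp add: s_def double_hole_nonneg)
        show "\<forall>\<^sub>F t in at_top. s t \<eta> \<le> remaining_work m \<eta> / t"
          using eventually_gt_at_top[of 0]
        proof eventually_elim
          case (elim t)
          then show ?case
            using double_hole_survival[OF m, of t] by (simp add: s_def field_simps)
        qed
        show "((\<lambda>t. remaining_work m \<eta> / t) \<longlongrightarrow> 0) at_top"
          by (intro tendsto_divide_0[OF tendsto_const] filterlim_at_top_imp_at_infinity filterlim_ident)
      qed
    qed
  qed auto
  moreover have "\<forall>\<^sub>F t in at_top. (\<integral>\<eta>. s t \<eta> \<partial>fair_product) = E fair_product t double_hole"
    using eventually_ge_at_top[of 0]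
  proof eventually_elim
    case (elim t)
    then show ?case
      by (simp add: E_eq_integral_kernel[OF mu elim cylinder_measurable[OF cylinder_double_hole] bound] s_def)
  qed
  ultimately show ?thesis
    by (simp add: filterlim_cong)
qed

end

section \<open>Weak convergence\<close>

text \<open>On a large window the configuration alternates with probability tending to one, and then its value at 0
decides which of the two alternating configurations it follows. So a bounded continuous \<open>f\<close> may be replaced by the
function \<open>g\<close> of the value at 0, whose expectation is known from the density.\<close>

theorem theorem3:
  fixes P :: "real \<Rightarrow> config \<Rightarrow> config measure"
  assumes "ftasep P"
  shows "weakly_converges (\<lambda>t. evolve (bernoulli_product (1/2)) P t) alternating_mixture at_top"
  unfolding weakly_converges_def
proof (intro allI impI, elim conjE)
  interpret ftasep P by (rule assms)
  note mu = bernoulli_product_prob[of "1/2"]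
  fix f :: "config \<Rightarrow> real"
  assume cont: "continuous_on UNIV f" and "bounded (range f)"
  then obtain M where M: "\<And>\<eta>. \<bar>f \<eta>\<bar> \<le> M"
    unfolding bounded_iff by auto
  have f: "f \<in> borel_measurable borel"
    using cont by (rule borel_measurable_continuous_onI)
  define g where "g \<eta> = (if \<eta> 0 then f alt0 else f alt1)" for \<eta> :: config
  have g: "cylinder g"
    by (rule cylinder_if_determined_by[of 0 0]) (simp add: determined_by_def g_def)
  have Eg: "E fair_product t g = (f alt1 + f alt0) / 2" if "0 \<le> t" for t
  proof -
    interpret prob_space "evolve fair_product P t"
      using evolve_prob[OF mu that] by (simp add: space_prob_algebra)
    have "g = (\<lambda>\<eta>. f alt1 + (f alt0 - f alt1) * of_bool (\<eta> 0))"
      by (auto simp: g_def)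
    then have "E fair_product t g = f alt1 + (f alt0 - f alt1) * (1/2)"
      using integrable_evolve_cylinder[OF mu that cylinder_coordinate, of 0] density_half[OF that, of 0]
      by (simp add: prob_space)
    then show ?thesis by (simp add: field_simps)
  qed
  have "((\<lambda>t. E fair_product t f) \<longlongrightarrow> (f alt1 + f alt0) / 2) at_top"
    unfolding tendsto_iff
  proof (intro allI impI)
    fix \<epsilon> :: real assume "\<epsilon> > 0"
    then have \<epsilon>: "\<epsilon> / 2 > 0" by simp
    obtain N0 where N0: "\<And>\<eta>. (\<And>x. \<bar>x\<bar> \<le> int N0 \<Longrightarrow> \<eta> x = alt0 x) \<Longrightarrow> \<bar>f \<eta> - f alt0\<bar> < \<epsilon> / 2"
      using continuous_config_oscillation[OF cont \<epsilon>] by blast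
    obtain N1 where N1: "\<And>\<eta>. (\<And>x. \<bar>x\<bar> \<le> int N1 \<Longrightarrow> \<eta> x = alt1 x) \<Longrightarrow> \<bar>f \<eta> - f alt1\<bar> < \<epsilon> / 2"
      using continuous_config_oscillation[OF cont \<epsilon>] by blast
    define N where "N = max N0 N1"
    define W where "W = {- int N..<int N}"
    define bad :: "config \<Rightarrow> real" where "bad \<eta> = (\<Sum>x\<in>W. of_bool (\<eta> x = \<eta> (x + 1)))" for \<eta>
    have close: "\<bar>f \<eta> - g \<eta>\<bar> \<le> \<epsilon> / 2 + 2 * M * bad \<eta>" for \<eta>
    proof (cases "\<exists>x\<in>W. \<eta> x = \<eta> (x + 1)")
      case True
      then obtain x where x: "x \<in> W" "\<eta> x = \<eta> (x + 1)" by blast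
      have "1 \<le> bad \<eta>"
        using member_le_sum[OF x(1), of "\<lambda>x. of_bool (\<eta> x = \<eta> (x + 1)) :: real"] x(2)
        by (simp add: bad_def W_def)
      moreover have "M \<ge> 0" using M[of \<eta>] by linarith
      ultimately have "2 * M * 1 \<le> 2 * M * bad \<eta>"
        by (intro mult_left_mono) auto
      moreover have "\<bar>f \<eta> - g \<eta>\<bar> \<le> 2 * M"
        using M[of \<eta>] M[of alt0] M[of alt1] by (auto simp: g_def)
      ultimately show ?thesis using \<epsilon> by linarith
    next
      case False
      then have alt: "\<eta> x = (if \<eta> 0 then alt0 x else alt1 x)" if "\<bar>x\<bar> \<le> int N" for x
        by (intro alternating_on_window[OF _ that]) (auto simp: W_def)
      have "\<bar>f \<eta> - g \<eta>\<bar> < \<epsilon> / 2"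
      proof (cases "\<eta> 0")
        case True
        have "\<eta> x = alt0 x" if "\<bar>x\<bar> \<le> int N0" for x
          using alt[of x] that True by (simp add: N_def)
        from N0[OF this] True show ?thesis by (simp add: g_def)
      next
        case False
        have "\<eta> x = alt1 x" if "\<bar>x\<bar> \<le> int N1" for x
          using alt[of x] that False by (simp add: N_def)
        from N1[OF this] False show ?thesis by (simp add: g_def)
      qed
      moreover have "bad \<eta> = 0" using False by (simp add: bad_def)
      ultimately show ?thesis by simp
    qed
    have bad_cyl: "cylinder (\<lambda>\<eta>. of_bool (\<eta> x = \<eta> (x + 1)))" for x
      by (rule cylinder_if_determined_by[of x "x + 1"]) (auto simp: determined_by_def)
    have "((\<lambda>t. 2 * M * (real (card W) * (2 * E fair_product t double_hole))) \<longlongrightarrow>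
        2 * M * (real (card W) * (2 * 0))) at_top"
      by (intro tendsto_intros double_hole_vanishes)
    then have "\<forall>\<^sub>F t in at_top. 2 * M * (real (card W) * (2 * E fair_product t double_hole)) < \<epsilon> / 2"
      using \<epsilon> by (intro order_tendstoD(2)) auto
    then show "\<forall>\<^sub>F t in at_top. dist (E fair_product t f) ((f alt1 + f alt0) / 2) < \<epsilon>"
      using eventually_ge_at_top[of 0]
    proof eventually_elim
      case (elim t)
      note prob = evolve_prob[OF mu elim(2)]
      interpret prob_space "evolve fair_product P t" using prob by (simp add: space_prob_algebra)
      have int_bad: "integrable (evolve fair_product P t) (\<lambda>\<eta>. of_bool (\<eta> x = \<eta> (x + 1)) :: real)" for x
        by (rule integrable_cylinder[OF prob bad_cyl])
      have int_f: "integrable (evolve fair_product P t) f"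
        by (rule integrable_bounded[OF prob f M])
      have int_g: "integrable (evolve fair_product P t) g"
        by (rule integrable_cylinder[OF prob g])
      have E_bad: "E fair_product t bad = real (card W) * (2 * E fair_product t double_hole)"
        using int_bad by (simp add: bad_def equal_neighbours[OF elim(2)])
      have "\<bar>E fair_product t f - E fair_product t g\<bar> = \<bar>E fair_product t (\<lambda>\<eta>. f \<eta> - g \<eta>)\<bar>"
        using int_f int_g by simp
      also have "\<dots> \<le> E fair_product t (\<lambda>\<eta>. \<bar>f \<eta> - g \<eta>\<bar>)" by simp
      also have "\<dots> \<le> E fair_product t (\<lambda>\<eta>. \<epsilon> / 2 + 2 * M * bad \<eta>)"
        using int_f int_g int_bad close by (intro integral_mono) (auto simp: bad_def)
      also have "\<dots> = \<epsilon> / 2 + 2 * M * E fair_product t bad"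
      proof -
        have "integrable (evolve fair_product P t) bad"
          unfolding bad_def[abs_def] using int_bad by simp
        then show ?thesis by (simp add: prob_space)
      qed
      finally show ?case
        using elim(1) by (simp add: E_bad Eg[OF elim(2)] dist_real_def)
    qed
  qed
  then show "((\<lambda>t. E fair_product t f) \<longlongrightarrow> (\<integral>\<xi>. f \<xi> \<partial>alternating_mixture)) at_top"
    by (simp add: integral_alternating_mixture[OF f])
qed

end
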